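(* For any fixed positive integer $d$, there is a (deterministic) algorithm that, given any positive integer $n$, any integer weight functions $w^1,\dots,w^d$ on $N=\{(i,j):1\le i,j\le n\}$, and any convex function $f:\mathbb{R}^d\to\mathbb{R}$ presented by a comparison oracle, solves the maximum nonlinear bipartite matching problem, that is, finds a perfect matching $M\subset N$ of $K_{n,n}$ maximizing $f(w^1(M),\dots,w^d(M))$ over all perfect matchings, in oracle-time which is polynomial in $n$ and $\max_{i,j,k}|w^k_{i,j}|$.
   Context: $N=\{(i,j):1\le i,j\le n\}$ is the edge set of the complete bipartite graph $K_{n,n}$. For a weight function $w^k:N\to\mathbb{Z}$ write $w^k_{i,j}=w^k(i,j)$, and for $M\subseteq N$ let $w^k(M):=\sum\{w^k(i,j):(i,j)\in M\}$. A comparison oracle for $f:\mathbb{R}^d\to\mathbb{R}$ is an oracle that, queried on $y,z\in\mathbb{Z}^d$, asserts whether or not $f(y)\le f(z)$. Oracle-time means the running time of the algorithm plus the number of oracle queries. *)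

theory Defs
  imports
    "HOL-Analysis.Analysis"
    "HOL-Library.Log_Nat"
    "HOL-Computational_Algebra.Polynomial"
begin

section \<open>Nonlinear bipartite matching\<close>

text \<open>The pair \<open>(i, j)\<close> stands for the edge joining the \<open>i\<close>-th vertex of the first side of
  $K_{n,n}$ to the \<open>j\<close>-th vertex of the second side.\<close>

definition edges :: "nat \<Rightarrow> (nat \<times> nat) set" where
  "edges n = {1..n} \<times> {1..n}"

definition perfect_matching :: "nat \<Rightarrow> (nat \<times> nat) set \<Rightarrow> bool" where
  "perfect_matching n M \<longleftrightarrow>
     M \<subseteq> edges n \<and>
     (\<forall>i\<in>{1..n}. \<exists>!j. (i, j) \<in> M) \<and>
     (\<forall>j\<in>{1..n}. \<exists>!i. (i, j) \<in> M)"

text \<open>The dimension \<open>d\<close> is \<open>CARD('d)\<close>; the weight functions are indexed by \<open>'d\<close>.\<close>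

definition weight_vector ::
  "('d::finite \<Rightarrow> nat \<times> nat \<Rightarrow> int) \<Rightarrow> (nat \<times> nat) set \<Rightarrow> real ^ 'd" where
  "weight_vector w M = (\<chi> k. real_of_int (\<Sum>e\<in>M. w k e))"

definition optimal_matching ::
  "nat \<Rightarrow> ('d::finite \<Rightarrow> nat \<times> nat \<Rightarrow> int) \<Rightarrow> (real ^ 'd \<Rightarrow> real) \<Rightarrow> (nat \<times> nat) set \<Rightarrow> bool" where
  "optimal_matching n w f M \<longleftrightarrow>
     perfect_matching n M \<and>
     (\<forall>M'. perfect_matching n M' \<longrightarrow> f (weight_vector w M') \<le> f (weight_vector w M))"

definition max_abs_weight :: "nat \<Rightarrow> ('d::finite \<Rightarrow> nat \<times> nat \<Rightarrow> int) \<Rightarrow> nat" where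
  "max_abs_weight n w = Max {nat \<bar>w k e\<bar> | k e. e \<in> edges n}"

definition comparison_oracle ::
  "(real ^ 'd::finite \<Rightarrow> real) \<Rightarrow> int ^ 'd \<Rightarrow> int ^ 'd \<Rightarrow> bool" where
  "comparison_oracle f y z \<longleftrightarrow>
     f (\<chi> k. real_of_int (y $ k)) \<le> f (\<chi> k. real_of_int (z $ k))"


section \<open>Deterministic oracle programs and their running time\<close>

text \<open>
  Algorithms are programs of a deterministic while language over integer registers, that is, a
  structured random access machine. The registers are grouped into finitely many arrays per
  program, each addressed by two integers that are computed at run time.

  Time follows the logarithmic cost criterion: every operation is charged for the bit lengths of
  the integers and register addresses it handles (multiplication for the product of the bit
  lengths, as in the schoolbook method). Running time is therefore that of a Turing machine up to
  a polynomial, and a program cannot profit from operating on huge integers at unit cost.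
\<close>

datatype 'd arr =
    Dim        \<comment> \<open>input: \<open>n\<close>, in register \<open>(0, 0)\<close>\<close>
  | Weight 'd  \<comment> \<open>input: the weight function with index \<open>k :: 'd\<close>\<close>
  | Out        \<comment> \<open>output: incidence matrix of the matching\<close>
  | Work nat   \<comment> \<open>auxiliary arrays\<close>

type_synonym 'd store = "'d arr \<Rightarrow> int \<Rightarrow> int \<Rightarrow> int"

datatype 'd aexp =
    Const int
  | Get "'d arr" "'d aexp" "'d aexp"
  | Add "'d aexp" "'d aexp"
  | Sub "'d aexp" "'d aexp"
  | Mul "'d aexp" "'d aexp"

datatype 'd bexp =
    Le "'d aexp" "'d aexp"
  | Neg "'d bexp"
  | Conj "'d bexp" "'d bexp"

text \<open>\<open>Query x a b y z\<close> submits the vectors computed by \<open>y\<close> and \<open>z\<close> to the oracle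
  and stores the answer, as 1 or 0, in register \<open>x[a, b]\<close>. As \<open>'d\<close> is going to be finite,
  programs are finite objects.\<close>

datatype 'd prog =
    Skip
  | Assign "'d arr" "'d aexp" "'d aexp" "'d aexp"
  | Query "'d arr" "'d aexp" "'d aexp" "'d \<Rightarrow> 'd aexp" "'d \<Rightarrow> 'd aexp"
  | Seq "'d prog" "'d prog"
  | Cond "'d bexp" "'d prog" "'d prog"
  | While "'d bexp" "'d prog"

primrec aval :: "'d aexp \<Rightarrow> 'd store \<Rightarrow> int" where
  "aval (Const c) s = c"
| "aval (Get x a b) s = s x (aval a s) (aval b s)"
| "aval (Add a b) s = aval a s + aval b s"
| "aval (Sub a b) s = aval a s - aval b s"
| "aval (Mul a b) s = aval a s * aval b s"

primrec bval :: "'d bexp \<Rightarrow> 'd store \<Rightarrow> bool" where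
  "bval (Le a b) s \<longleftrightarrow> aval a s \<le> aval b s"
| "bval (Neg b) s \<longleftrightarrow> \<not> bval b s"
| "bval (Conj b c) s \<longleftrightarrow> bval b s \<and> bval c s"

text \<open>One bit for the sign, and the binary digits of the absolute value.\<close>

definition bit_length :: "int \<Rightarrow> nat" where
  "bit_length z = Suc (floorlog 2 (nat \<bar>z\<bar>))"

primrec acost :: "'d aexp \<Rightarrow> 'd store \<Rightarrow> nat" where
  "acost (Const c) s = bit_length c"
| "acost (Get x a b) s =
     acost a s + acost b s + bit_length (aval a s) + bit_length (aval b s)
     + bit_length (s x (aval a s) (aval b s))"
| "acost (Add a b) s = acost a s + acost b s + bit_length (aval a s) + bit_length (aval b s)"
| "acost (Sub a b) s = acost a s + acost b s + bit_length (aval a s) + bit_length (aval b s)"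
| "acost (Mul a b) s = acost a s + acost b s + bit_length (aval a s) * bit_length (aval b s)"

primrec bcost :: "'d bexp \<Rightarrow> 'd store \<Rightarrow> nat" where
  "bcost (Le a b) s = acost a s + acost b s + bit_length (aval a s) + bit_length (aval b s)"
| "bcost (Neg b) s = 1 + bcost b s"
| "bcost (Conj b c) s = 1 + bcost b s + bcost c s"

definition update :: "'d arr \<Rightarrow> int \<Rightarrow> int \<Rightarrow> int \<Rightarrow> 'd store \<Rightarrow> 'd store" where
  "update x i j v s = s(x := (s x)(i := (s x i)(j := v)))"

text \<open>\<open>exec orac P s t q s'\<close>: started in \<open>s\<close>, the program \<open>P\<close> with oracle \<open>orac\<close> halts
  in \<open>s'\<close> after time \<open>t\<close>, having made \<open>q\<close> oracle queries.\<close>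

inductive exec ::
  "(int ^ 'd::finite \<Rightarrow> int ^ 'd \<Rightarrow> bool) \<Rightarrow> 'd prog \<Rightarrow> 'd store \<Rightarrow> nat \<Rightarrow> nat \<Rightarrow> 'd store \<Rightarrow> bool"
  for orac where
  Skip: "exec orac Skip s 1 0 s"
| Assign: "exec orac (Assign x a b e) s
     (1 + acost a s + acost b s + acost e s
      + bit_length (aval a s) + bit_length (aval b s) + bit_length (aval e s))
     0 (update x (aval a s) (aval b s) (aval e s) s)"
| Query: "exec orac (Query x a b y z) s
     (1 + acost a s + acost b s + bit_length (aval a s) + bit_length (aval b s)
      + (\<Sum>k\<in>UNIV. acost (y k) s + acost (z k) s
                    + bit_length (aval (y k) s) + bit_length (aval (z k) s)))
     1 (update x (aval a s) (aval b s)
          (of_bool (orac (\<chi> k. aval (y k) s) (\<chi> k. aval (z k) s))) s)"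
| Seq: "exec orac P s t q s' \<Longrightarrow> exec orac Q s' t' q' s'' \<Longrightarrow>
     exec orac (Seq P Q) s (1 + t + t') (q + q') s''"
| Cond_True: "bval b s \<Longrightarrow> exec orac P s t q s' \<Longrightarrow>
     exec orac (Cond b P Q) s (1 + bcost b s + t) q s'"
| Cond_False: "\<not> bval b s \<Longrightarrow> exec orac Q s t q s' \<Longrightarrow>
     exec orac (Cond b P Q) s (1 + bcost b s + t) q s'"
| While_False: "\<not> bval b s \<Longrightarrow> exec orac (While b P) s (1 + bcost b s) 0 s"
| While_True: "bval b s \<Longrightarrow> exec orac P s t q s' \<Longrightarrow> exec orac (While b P) s' t' q' s'' \<Longrightarrow>
     exec orac (While b P) s (1 + bcost b s + t + t') (q + q') s''"

inductive_cases exec_SkipE: "exec orac Skip s t q s'"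
inductive_cases exec_AssignE: "exec orac (Assign x a b e) s t q s'"
inductive_cases exec_QueryE: "exec orac (Query x a b y z) s t q s'"
inductive_cases exec_SeqE: "exec orac (Seq P Q) s t q s'"
inductive_cases exec_CondE: "exec orac (Cond b P Q) s t q s'"
inductive_cases exec_WhileE: "exec orac (While b P) s t q s'"

text \<open>Hence the existence of a halting execution says that the run of the program halts.\<close>

lemma exec_deterministic:
  assumes "exec orac P s t q s'" and "exec orac P s t' q' s''"
  shows "t = t' \<and> q = q' \<and> s' = s''"
  using assms
proof (induction arbitrary: t' q' s'' rule: exec.induct)
  case Skip
  then show ?case by (auto elim: exec_SkipE)
next
  case Assign
  then show ?case by (auto elim: exec_AssignE)
next
  case Query
  then show ?case by (auto elim: exec_QueryE)
next
  case Seq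
  from Seq.prems show ?case by (rule exec_SeqE) (auto dest!: Seq.IH)
next
  case Cond_True
  from Cond_True.prems show ?case by (rule exec_CondE) (use Cond_True.hyps(1) in \<open>auto dest!: Cond_True.IH\<close>)+
next
  case Cond_False
  from Cond_False.prems show ?case by (rule exec_CondE) (use Cond_False.hyps(1) in \<open>auto dest!: Cond_False.IH\<close>)+
next
  case While_False
  from While_False.prems show ?case by (rule exec_WhileE) (use While_False.hyps(1) in auto)+
next
  case While_True
  from While_True.prems show ?case by (rule exec_WhileE) (use While_True.hyps(1) in \<open>auto dest!: While_True.IH\<close>)+
qed


section \<open>Input and output\<close>

text \<open>Registers that do not belong to the input are 0; in particular, values of the weight
  functions outside \<open>edges n\<close> are not visible to a program.\<close>

definition input_store :: "nat \<Rightarrow> ('d \<Rightarrow> nat \<times> nat \<Rightarrow> int) \<Rightarrow> 'd store" where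
  "input_store n w x i j = (case x of
       Dim \<Rightarrow> if i = 0 \<and> j = 0 then int n else 0
     | Weight k \<Rightarrow>
         if 1 \<le> i \<and> i \<le> int n \<and> 1 \<le> j \<and> j \<le> int n then w k (nat i, nat j) else 0
     | Out \<Rightarrow> 0
     | Work m \<Rightarrow> 0)"

definition output_matching :: "nat \<Rightarrow> 'd store \<Rightarrow> (nat \<times> nat) set" where
  "output_matching n s = {(i, j) \<in> edges n. s Out (int i) (int j) \<noteq> 0}"

end

theory Submission
  imports Defs
begin

text \<open>
  The weight vectors of the perfect matchings form a finite set \<open>S\<close> of integer points, and a convex
  \<open>f\<close> attains its maximum over \<open>S\<close> at an extreme point \<open>v\<close> of the convex hull. Some linear functional
  has \<open>v\<close> as its only maximiser on \<open>S\<close>. Such functionals are the solutions of the homogeneous strict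
  inequalities \<open>c \<bullet> (v - u) > 0\<close> for \<open>u \<in> S - {v}\<close>, whose integer coefficients are polynomially
  bounded in \<open>n\<close> and the largest weight. Fourier--Motzkin elimination squares the size of the
  coefficients once per variable; the number of variables is the fixed dimension, so there is even an
  integer solution \<open>c\<close> whose entries are bounded by a polynomial
  (\<open>strict_inequalities_small_integer_solution\<close>, \<open>convex_max_small_functional\<close>).

  It therefore suffices to run through the polynomially many integer vectors \<open>c\<close> in a box, to find
  for each of them a matching of maximum weight with respect to the single weight function
  \<open>\<Sum>k. c k * w k\<close>, and to keep the best of these matchings according to the oracle: when \<open>c\<close> is the
  vector that exposes \<open>v\<close>, every matching of maximum weight has the weight vector \<open>v\<close>.

  The combined weights are polynomially bounded too, so a pseudo-polynomial assignment algorithm is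
  good enough. The one used is Bertsekas' auction: an unassigned person takes the object that
  is most profitable at current prices, and its price goes up by one. Every assigned person is
  content up to one unit, so the final assignment is optimal up to \<open>n\<close>, and exactly optimal if all
  weights have been multiplied by \<open>n + 1\<close> (\<open>auction_optimal\<close>). While somebody is unassigned, some object
  is still free of charge, which bounds all prices and hence the number of bids (\<open>auction_bid\<close>).

  The running time is obtained without tracking it through the correctness proof. If one number \<open>V\<close>
  bounds the absolute values of all registers and the number of iterations of each loop, then the
  time is at most a polynomial in \<open>V\<close> that depends on the text of the program only (\<open>time_bound\<close>).
  All that remains to be shown is that registers and loop counters stay polynomially bounded.
\<close>

section \<open>A program logic with uniform time bounds\<close>

text \<open>
  The polynomials below are to be evaluated at a common bound \<open>V\<close> for the absolute values of all
  registers; the monomial \<open>[:0, 1:]\<close> stands for the content of a register.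
\<close>

primrec aval_bound :: "'d aexp \<Rightarrow> nat poly" where
  "aval_bound (Const c) = [:nat \<bar>c\<bar>:]"
| "aval_bound (Get x a b) = [:0, 1:]"
| "aval_bound (Add a b) = aval_bound a + aval_bound b"
| "aval_bound (Sub a b) = aval_bound a + aval_bound b"
| "aval_bound (Mul a b) = aval_bound a * aval_bound b"

primrec acost_bound :: "'d aexp \<Rightarrow> nat poly" where
  "acost_bound (Const c) = 1 + [:nat \<bar>c\<bar>:]"
| "acost_bound (Get x a b) =
     acost_bound a + acost_bound b + (1 + aval_bound a) + (1 + aval_bound b) + (1 + [:0, 1:])"
| "acost_bound (Add a b) = acost_bound a + acost_bound b + (1 + aval_bound a) + (1 + aval_bound b)"
| "acost_bound (Sub a b) = acost_bound a + acost_bound b + (1 + aval_bound a) + (1 + aval_bound b)"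
| "acost_bound (Mul a b) = acost_bound a + acost_bound b + (1 + aval_bound a) * (1 + aval_bound b)"

primrec bcost_bound :: "'d bexp \<Rightarrow> nat poly" where
  "bcost_bound (Le a b) = acost_bound a + acost_bound b + (1 + aval_bound a) + (1 + aval_bound b)"
| "bcost_bound (Neg b) = 1 + bcost_bound b"
| "bcost_bound (Conj b c) = 1 + bcost_bound b + bcost_bound c"

text \<open>The argument of the polynomial also serves as a bound for the number of iterations each time a loop
  is executed; the additional \<open>1\<close> in the clause for loops pays for the last, failing test.\<close>

primrec time_bound :: "'d::finite prog \<Rightarrow> nat poly" where
  "time_bound Skip = 1"
| "time_bound (Assign x a b e) = 1 + acost_bound a + acost_bound b + acost_bound e
     + (1 + aval_bound a) + (1 + aval_bound b) + (1 + aval_bound e)"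
| "time_bound (Query x a b y z) = 2 + acost_bound a + acost_bound b
     + (1 + aval_bound a) + (1 + aval_bound b)
     + (\<Sum>k\<in>UNIV. acost_bound (y k) + acost_bound (z k)
                   + (1 + aval_bound (y k)) + (1 + aval_bound (z k)))"
| "time_bound (Seq P Q) = 1 + time_bound P + time_bound Q"
| "time_bound (Cond b P Q) = 1 + bcost_bound b + time_bound P + time_bound Q"
| "time_bound (While b P) = (1 + [:0, 1:]) * (1 + bcost_bound b + time_bound P)"

definition bounded_store :: "nat \<Rightarrow> 'd store \<Rightarrow> bool" where
  "bounded_store V s \<longleftrightarrow> (\<forall>x i j. \<bar>s x i j\<bar> \<le> int V)"

text \<open>Bounding a bit length by the number itself is wasteful, but a time bound that is polynomial in the
  weights rather than in their lengths can afford it.\<close>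

lemma bit_length_le: "nat \<bar>z\<bar> \<le> m \<Longrightarrow> bit_length z \<le> Suc m"
proof -
  assume "nat \<bar>z\<bar> \<le> m"
  moreover have "floorlog 2 (nat \<bar>z\<bar>) \<le> nat \<bar>z\<bar>"
    by (rule floorlog_leI) auto
  ultimately show ?thesis
    by (simp add: bit_length_def)
qed

lemma aval_bound: "bounded_store V s \<Longrightarrow> nat \<bar>aval e s\<bar> \<le> poly (aval_bound e) V"
proof (induction e)
  case (Get x a b)
  then have "\<bar>s x (aval a s) (aval b s)\<bar> \<le> int V"
    by (simp add: bounded_store_def)
  then show ?case by simp
next
  case (Mul a b)
  then have "nat \<bar>aval a s\<bar> * nat \<bar>aval b s\<bar> \<le> poly (aval_bound a) V * poly (aval_bound b) V"
    by (intro mult_mono) auto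
  then show ?case by (simp add: abs_mult nat_mult_distrib)
qed auto

lemma bit_length_aval: "bounded_store V s \<Longrightarrow> bit_length (aval e s) \<le> Suc (poly (aval_bound e) V)"
  by (rule bit_length_le[OF aval_bound])

lemma acost_bound: "bounded_store V s \<Longrightarrow> acost e s \<le> poly (acost_bound e) V"
proof (induction e)
  case (Const c)
  then show ?case using bit_length_le[of c] by simp
next
  case (Get x a b)
  then have "bit_length (s x (aval a s) (aval b s)) \<le> Suc V"
    by (intro bit_length_le) (simp add: bounded_store_def nat_le_iff)
  with Get bit_length_aval[OF Get.prems, of a] bit_length_aval[OF Get.prems, of b]
  show ?case by simp
next
  case (Add a b)
  with bit_length_aval[OF Add.prems, of a] bit_length_aval[OF Add.prems, of b]
  show ?case by simp
next
  case (Sub a b)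
  with bit_length_aval[OF Sub.prems, of a] bit_length_aval[OF Sub.prems, of b]
  show ?case by simp
next
  case (Mul a b)
  have "bit_length (aval a s) * bit_length (aval b s)
      \<le> Suc (poly (aval_bound a) V) * Suc (poly (aval_bound b) V)"
    by (intro mult_mono bit_length_aval Mul.prems) auto
  with Mul show ?case by simp
qed

lemma bcost_bound: "bounded_store V s \<Longrightarrow> bcost b s \<le> poly (bcost_bound b) V"
proof (induction b)
  case (Le a b)
  with bit_length_aval[OF Le, of a] bit_length_aval[OF Le, of b]
    acost_bound[OF Le, of a] acost_bound[OF Le, of b]
  show ?case by simp
qed auto

primrec writes :: "'d prog \<Rightarrow> 'd arr set" where
  "writes Skip = {}"
| "writes (Assign x a b e) = {x}"
| "writes (Query x a b y z) = {x}"
| "writes (Seq P Q) = writes P \<union> writes Q"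
| "writes (Cond b P Q) = writes P \<union> writes Q"
| "writes (While b P) = writes P"

definition agree_off :: "'d arr set \<Rightarrow> 'd store \<Rightarrow> 'd store \<Rightarrow> bool" where
  "agree_off X s s' \<longleftrightarrow> (\<forall>x. x \<notin> X \<longrightarrow> s' x = s x)"

lemma agree_off_refl [simp]: "agree_off X s s"
  by (simp add: agree_off_def)

lemma agree_off_trans: "agree_off X s s' \<Longrightarrow> agree_off X s' s'' \<Longrightarrow> agree_off X s s''"
  by (simp add: agree_off_def)

lemma agree_off_mono: "agree_off X s s' \<Longrightarrow> X \<subseteq> Y \<Longrightarrow> agree_off Y s s'"
  by (auto simp: agree_off_def)

lemma agree_offD: "agree_off X s s' \<Longrightarrow> x \<notin> X \<Longrightarrow> s' x = s x"
  by (simp add: agree_off_def)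

lemma update_other [simp]: "y \<noteq> x \<Longrightarrow> update x i j v s y = s y"
  by (simp add: update_def)

lemma update_same [simp]: "update x i j v s x = (s x)(i := (s x i)(j := v))"
  by (simp add: update_def)

lemma agree_off_update [simp]: "x \<in> X \<Longrightarrow> agree_off X s (update x i j v s)"
  by (auto simp: agree_off_def update_def)

text \<open>A frame rule: specifications of program parts need not list the arrays that they leave alone.\<close>

lemma exec_agree_off: "exec orac P s t q s' \<Longrightarrow> agree_off (writes P) s s'"
  by (induction rule: exec.induct) (auto simp: agree_off_def)

text \<open>A total-correctness judgement in which neither time nor the boundedness of intermediate
  stores is visible: both are controlled by \<open>V\<close>.\<close>

definition runs ::
  "(int ^ 'd::finite \<Rightarrow> int ^ 'd \<Rightarrow> bool) \<Rightarrow> nat \<Rightarrow> 'd prog \<Rightarrow> 'd store \<Rightarrow> ('d store \<Rightarrow> bool) \<Rightarrow> bool" where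
  "runs orac V P s Q \<longleftrightarrow>
     (\<exists>t q s'. exec orac P s t q s' \<and> t + q \<le> poly (time_bound P) V \<and> bounded_store V s' \<and> Q s')"

lemma runs_conseq:
  assumes "runs orac V P s Q"
    and "\<And>s'. Q s' \<Longrightarrow> bounded_store V s' \<Longrightarrow> agree_off (writes P) s s' \<Longrightarrow> R s'"
  shows "runs orac V P s R"
  using assms exec_agree_off unfolding runs_def by blast

lemma runs_Skip: "bounded_store V s \<Longrightarrow> Q s \<Longrightarrow> runs orac V Skip s Q"
  unfolding runs_def by (auto intro!: exI exec.Skip)

lemma bounded_store_update:
  "bounded_store V s \<Longrightarrow> \<bar>v\<bar> \<le> int V \<Longrightarrow> bounded_store V (update x i j v s)"
  by (simp add: bounded_store_def update_def)

lemma runs_Assign: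
  assumes "bounded_store V s" and "\<bar>aval e s\<bar> \<le> int V"
    and "Q (update x (aval a s) (aval b s) (aval e s) s)"
  shows "runs orac V (Assign x a b e) s Q"
proof -
  have "1 + acost a s + acost b s + acost e s
      + bit_length (aval a s) + bit_length (aval b s) + bit_length (aval e s) + 0
    \<le> poly (time_bound (Assign x a b e)) V"
    using acost_bound[OF assms(1), of a] acost_bound[OF assms(1), of b] acost_bound[OF assms(1), of e]
      bit_length_aval[OF assms(1), of a] bit_length_aval[OF assms(1), of b]
      bit_length_aval[OF assms(1), of e]
    by simp
  moreover have "bounded_store V (update x (aval a s) (aval b s) (aval e s) s)"
    using assms by (intro bounded_store_update)
  ultimately show ?thesis
    unfolding runs_def using assms(3) exec.Assign by blast
qed

lemma runs_Query:
  assumes "bounded_store V s" and "1 \<le> V"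
    and "Q (update x (aval a s) (aval b s)
              (of_bool (orac (\<chi> k. aval (y k) s) (\<chi> k. aval (z k) s))) s)"
  shows "runs orac V (Query x a b y z) s Q"
proof -
  let ?s' = "update x (aval a s) (aval b s)
              (of_bool (orac (\<chi> k. aval (y k) s) (\<chi> k. aval (z k) s))) s"
  have "(\<Sum>k\<in>UNIV. acost (y k) s + acost (z k) s
                    + bit_length (aval (y k) s) + bit_length (aval (z k) s))
    \<le> (\<Sum>k\<in>UNIV. poly (acost_bound (y k)) V + poly (acost_bound (z k)) V
                    + Suc (poly (aval_bound (y k)) V) + Suc (poly (aval_bound (z k)) V))"
    by (intro sum_mono add_mono acost_bound bit_length_aval assms(1))
  then have "1 + acost a s + acost b s + bit_length (aval a s) + bit_length (aval b s)
      + (\<Sum>k\<in>UNIV. acost (y k) s + acost (z k) s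
                    + bit_length (aval (y k) s) + bit_length (aval (z k) s)) + 1
    \<le> poly (time_bound (Query x a b y z)) V"
    using acost_bound[OF assms(1), of a] acost_bound[OF assms(1), of b]
      bit_length_aval[OF assms(1), of a] bit_length_aval[OF assms(1), of b]
    by (simp add: poly_sum)
  moreover have "bounded_store V ?s'"
    using assms by (intro bounded_store_update) auto
  ultimately show ?thesis
    unfolding runs_def using assms(3) exec.Query by blast
qed

lemma runs_Seq:
  assumes "runs orac V P s R" and "\<And>s'. R s' \<Longrightarrow> bounded_store V s' \<Longrightarrow>
      agree_off (writes P) s s' \<Longrightarrow> runs orac V P' s' Q"
  shows "runs orac V (Seq P P') s Q"
proof -
  obtain t q s' where 1: "exec orac P s t q s'" "t + q \<le> poly (time_bound P) V"
    "bounded_store V s'" "R s'"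
    using assms(1) unfolding runs_def by blast
  obtain t' q' s'' where 2: "exec orac P' s' t' q' s''" "t' + q' \<le> poly (time_bound P') V"
    "bounded_store V s''" "Q s''"
    using assms(2)[OF 1(4,3) exec_agree_off[OF 1(1)]] unfolding runs_def by blast
  have "(1 + t + t') + (q + q') \<le> poly (time_bound (Seq P P')) V"
    using 1 2 by simp
  with exec.Seq[OF 1(1) 2(1)] 2 show ?thesis
    unfolding runs_def by blast
qed

lemma runs_Assign_Seq:
  assumes "bounded_store V s" and "\<bar>aval e s\<bar> \<le> int V"
    and "bounded_store V (update x (aval a s) (aval b s) (aval e s) s) \<Longrightarrow>
      runs orac V P (update x (aval a s) (aval b s) (aval e s) s) Q"
  shows "runs orac V (Seq (Assign x a b e) P) s Q"
proof (rule runs_Seq)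
  show "runs orac V (Assign x a b e) s (\<lambda>s'. s' = update x (aval a s) (aval b s) (aval e s) s)"
    by (rule runs_Assign[OF assms(1,2)]) simp
qed (use assms(3) in simp)

lemma runs_Cond:
  assumes "bounded_store V s"
    and "bval b s \<Longrightarrow> runs orac V P s Q" and "\<not> bval b s \<Longrightarrow> runs orac V P' s Q"
  shows "runs orac V (Cond b P P') s Q"
proof (cases "bval b s")
  case True
  then obtain t q s' where 1: "exec orac P s t q s'" "t + q \<le> poly (time_bound P) V"
    "bounded_store V s'" "Q s'"
    using assms(2) unfolding runs_def by blast
  have "(1 + bcost b s + t) + q \<le> poly (time_bound (Cond b P P')) V"
    using 1 bcost_bound[OF assms(1), of b] by simp
  with exec.Cond_True[OF True 1(1)] 1 show ?thesis
    unfolding runs_def by blast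
next
  case False
  then obtain t q s' where 1: "exec orac P' s t q s'" "t + q \<le> poly (time_bound P') V"
    "bounded_store V s'" "Q s'"
    using assms(3) unfolding runs_def by blast
  have "(1 + bcost b s + t) + q \<le> poly (time_bound (Cond b P P')) V"
    using 1 bcost_bound[OF assms(1), of b] by simp
  with exec.Cond_False[OF False 1(1)] 1 show ?thesis
    unfolding runs_def by blast
qed

text \<open>The index of the invariant is the exact number of iterations to come, so that \<open>m \<le> V\<close> keeps
  the loop within its share of \<open>time_bound\<close>.\<close>

lemma runs_While:
  fixes I :: "nat \<Rightarrow> 'd::finite store \<Rightarrow> bool"
  assumes "I m s" and "m \<le> V" and "bounded_store V s"
    and stop: "\<And>s. I 0 s \<Longrightarrow> \<not> bval b s"
    and step: "\<And>m s. I (Suc m) s \<Longrightarrow> bounded_store V s \<Longrightarrow> bval b s \<and> runs orac V P s (I m)"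
  shows "runs orac V (While b P) s (I 0)"
proof -
  let ?c = "1 + poly (bcost_bound b) V + poly (time_bound P) V"
  have "\<exists>t q s'. exec orac (While b P) s t q s' \<and> t + q \<le> Suc m * ?c \<and> bounded_store V s' \<and> I 0 s'"
    using assms(1,3)
  proof (induction m arbitrary: s)
    case 0
    then show ?case
      using exec.While_False[OF stop[OF 0(1)], of orac P] bcost_bound[OF 0(2), of b]
      by (intro exI conjI) auto
  next
    case (Suc m)
    note b = step[OF Suc.prems]
    then obtain t q s' where 1: "exec orac P s t q s'" "t + q \<le> poly (time_bound P) V"
      "bounded_store V s'" "I m s'"
      unfolding runs_def by blast
    obtain t' q' s'' where 2: "exec orac (While b P) s' t' q' s''" "t' + q' \<le> Suc m * ?c"
      "bounded_store V s''" "I 0 s''"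
      using Suc.IH[OF 1(4,3)] by blast
    have "(1 + bcost b s + t + t') + (q + q') \<le> Suc (Suc m) * ?c"
      using 1 2 bcost_bound[OF Suc.prems(2), of b] by simp
    with exec.While_True[OF conjunct1[OF b] 1(1) 2(1)] 2 show ?case
      by blast
  qed
  moreover have "Suc m * ?c \<le> poly (time_bound (While b P)) V"
  proof -
    have "Suc m * ?c \<le> Suc V * ?c"
      using assms(2) by (intro mult_right_mono) auto
    then show ?thesis by simp
  qed
  ultimately show ?thesis
    unfolding runs_def using le_trans by blast
qed

section \<open>Counting loops\<close>

abbreviation scalar :: "nat \<Rightarrow> 'd aexp" where
  "scalar m \<equiv> Get (Work m) (Const 0) (Const 0)"

abbreviation set_scalar :: "nat \<Rightarrow> 'd aexp \<Rightarrow> 'd prog" where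
  "set_scalar m e \<equiv> Assign (Work m) (Const 0) (Const 0) e"

definition For :: "nat \<Rightarrow> 'd aexp \<Rightarrow> 'd aexp \<Rightarrow> 'd prog \<Rightarrow> 'd prog" where
  "For m lo hi P = Seq (set_scalar m lo)
     (While (Le (scalar m) hi) (Seq P (set_scalar m (Add (scalar m) (Const 1)))))"

lemma writes_For [simp]: "writes (For m lo hi P) = insert (Work m) (writes P)"
  by (auto simp: For_def)

text \<open>\<open>I i\<close> holds when the loop variable has reached \<open>i\<close> and the body has been run for all smaller values.
  The loop variable is incremented only after the body has established \<open>I (i + 1)\<close>, hence the
  requirement that \<open>I i\<close> be insensitive to its register. The range conditions bound the
  loop variable, including its final value \<open>h + 1\<close>, and the number of iterations.\<close>

lemma runs_For:
  fixes I :: "int \<Rightarrow> 'd::finite store \<Rightarrow> bool"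
  assumes "bounded_store V s" and I0: "I l s" and "aval lo s = l"
    and hi: "\<And>s'. agree_off (insert (Work m) (writes P)) s s' \<Longrightarrow> aval hi s' = h"
    and m: "Work m \<notin> writes P"
    and range: "l \<le> h + 1" "\<bar>l\<bar> \<le> int V" "\<bar>h + 1\<bar> \<le> int V" "h + 1 - l \<le> int V"
    and indep: "\<And>i v s. I i s \<Longrightarrow> I i (update (Work m) 0 0 v s)"
    and step: "\<And>i s'. l \<le> i \<Longrightarrow> i \<le> h \<Longrightarrow> I i s' \<Longrightarrow> s' (Work m) 0 0 = i \<Longrightarrow>
        bounded_store V s' \<Longrightarrow> agree_off (insert (Work m) (writes P)) s s' \<Longrightarrow>
        runs orac V P s' (I (i + 1))"
  shows "runs orac V (For m lo hi P) s (I (h + 1))"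
proof -
  \<comment> \<open>\<open>k\<close> iterations remain.\<close>
  define J where "J = (\<lambda>k s'. agree_off (insert (Work m) (writes P)) s s' \<and>
    s' (Work m) 0 0 = h + 1 - int k \<and> l \<le> h + 1 - int k \<and> I (h + 1 - int k) s')"
  have nl: "int (nat (h + 1 - l)) = h + 1 - l"
    using range by simp
  show ?thesis unfolding For_def
  proof (rule runs_Seq[where R = "J (nat (h + 1 - l))"])
    show "runs orac V (set_scalar m lo) s (J (nat (h + 1 - l)))"
      by (rule runs_Assign) (use assms nl in \<open>auto simp: J_def\<close>)
    fix s' assume J: "J (nat (h + 1 - l)) s'" and b: "bounded_store V s'"
    have "runs orac V (While (Le (scalar m) hi) (Seq P (set_scalar m (Add (scalar m) (Const 1))))) s' (J 0)"
    proof (rule runs_While[where I = J, OF J _ b])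
      show "nat (h + 1 - l) \<le> V" using range by simp
      show "\<not> bval (Le (scalar m) hi) s'" if "J 0 s'" for s'
        using that hi[of s'] by (simp add: J_def)
      fix k s' assume J: "J (Suc k) s'" and b: "bounded_store V s'"
      have bv: "bval (Le (scalar m) hi) s'"
        using J hi[of s'] by (simp add: J_def)
      let ?i = "h + 1 - int (Suc k)"
      have run: "runs orac V P s' (I (?i + 1))"
        by (rule step) (use J b in \<open>auto simp: J_def\<close>)
      have "runs orac V (Seq P (set_scalar m (Add (scalar m) (Const 1)))) s' (J k)"
      proof (rule runs_Seq[OF run])
        fix s'' assume I: "I (?i + 1) s''" and b: "bounded_store V s''"
          and ag: "agree_off (writes P) s' s''"
        have eq: "s'' (Work m) 0 0 = ?i"
          using agree_offD[OF ag m] J by (simp add: J_def)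
        have I': "I (h + 1 - int k) s''"
          using I by (simp add: algebra_simps)
        have "agree_off (insert (Work m) (writes P)) s s''"
          using J agree_off_trans agree_off_mono[OF ag, of "insert (Work m) (writes P)"]
          unfolding J_def by blast
        then have "agree_off (insert (Work m) (writes P)) s (update (Work m) 0 0 v s'')" for v
          by (rule agree_off_trans) simp
        moreover have "\<bar>?i + 1\<bar> \<le> int V"
          using range J unfolding J_def by linarith
        ultimately show "runs orac V (set_scalar m (Add (scalar m) (Const 1))) s'' (J k)"
          by (intro runs_Assign b) (use I' eq J in \<open>auto simp: J_def intro: indep\<close>)
      qed
      with bv show "bval (Le (scalar m) hi) s' \<and>
        runs orac V (Seq P (set_scalar m (Add (scalar m) (Const 1)))) s' (J k)" by blast
    qed
    then show "runs orac V (While (Le (scalar m) hi) (Seq P (set_scalar m (Add (scalar m) (Const 1))))) s' (I (h + 1))"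
      by (rule runs_conseq) (simp add: J_def)
  qed
qed

section \<open>Small integer solutions of homogeneous strict inequalities\<close>

text \<open>
  The mediant \<open>(r - p) / (\<alpha> + \<beta>)\<close> lies strictly between \<open>- p / \<alpha>\<close> and \<open>r / \<beta>\<close>. So it satisfies
  the constraint \<open>u + \<gamma> * t > 0\<close> whenever the lower bound \<open>- u / \<gamma>\<close> that this constraint puts on \<open>t\<close>
  is at most \<open>- p / \<alpha>\<close>. The denominator of the mediant is cleared.
\<close>

lemma strict_between_combination:
  fixes \<alpha> \<beta> \<gamma> :: int
  assumes pos: "0 < \<beta> * p + \<alpha> * r" "0 < \<alpha>" "0 < \<beta>"
    and "0 < \<gamma>" and "\<gamma> * p \<le> \<alpha> * u"
  shows "0 < (\<alpha> + \<beta>) * u + \<gamma> * (r - p)"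
proof -
  have "0 < \<gamma> * (\<beta> * p + \<alpha> * r)"
    using assms by simp
  also have "\<dots> = (\<alpha> + \<beta>) * (\<gamma> * p) + \<alpha> * (\<gamma> * (r - p))"
    by (simp add: algebra_simps)
  also have "\<dots> \<le> (\<alpha> + \<beta>) * (\<alpha> * u) + \<alpha> * (\<gamma> * (r - p))"
    using assms by (intro add_right_mono mult_left_mono) auto
  also have "\<dots> = \<alpha> * ((\<alpha> + \<beta>) * u + \<gamma> * (r - p))"
    by (simp add: algebra_simps)
  finally show ?thesis
    using pos(2) zero_less_mult_pos by blast
qed

lemma minimal_ratio:
  fixes S D :: "'a \<Rightarrow> int"
  assumes "finite A" and "A \<noteq> {}" and "\<And>a. a \<in> A \<Longrightarrow> 0 < D a"
  obtains a where "a \<in> A" and "\<And>b. b \<in> A \<Longrightarrow> S a * D b \<le> S b * D a"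
proof -
  define \<rho> where "\<rho> = (\<lambda>a. real_of_int (S a) / real_of_int (D a))"
  obtain a where a: "a \<in> A" "\<And>b. b \<in> A \<Longrightarrow> \<rho> a \<le> \<rho> b"
    using arg_min_if_finite[OF assms(1,2), of \<rho>] by (metis not_less)
  have "S a * D b \<le> S b * D a" if "b \<in> A" for b
  proof -
    have "real_of_int (S a * D b) \<le> real_of_int (S b * D a)"
      using a(2)[OF that] assms(3)[OF a(1)] assms(3)[OF that]
      by (simp add: \<rho>_def divide_simps mult.commute)
    then show ?thesis by linarith
  qed
  with a(1) show thesis using that by blast
qed

text \<open>One back substitution of Fourier--Motzkin elimination: if \<open>c'\<close> solves the system from which the
  variable \<open>k\<close> has been eliminated, then a value for \<open>k\<close> can be found between the largest lower and the
  smallest upper bound. To stay within the integers, the solution is \<open>m * c'\<close>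
  together with \<open>t\<close> at position \<open>k\<close>, where \<open>t / m\<close> is the mediant of these two bounds.\<close>

lemma strict_inequalities_elim_var:
  fixes A :: "('d \<Rightarrow> int) set" and c' :: "'d \<Rightarrow> int"
  defines "S \<equiv> \<lambda>K a. \<Sum>l\<in>K. a l * c' l"
  assumes K: "finite K" "k \<notin> K" and A: "finite A" "\<And>a. a \<in> A \<Longrightarrow> \<bar>a k\<bar> \<le> int R"
    and S: "\<And>a. a \<in> A \<Longrightarrow> \<bar>S K a\<bar> \<le> int D"
    and zero: "\<And>a. a \<in> A \<Longrightarrow> a k = 0 \<Longrightarrow> 0 < S K a"
    and pair: "\<And>a b. a \<in> A \<Longrightarrow> b \<in> A \<Longrightarrow> 0 < a k \<Longrightarrow> b k < 0 \<Longrightarrow>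
      0 < a k * S K b - b k * S K a"
  obtains m t where "0 < m" "m \<le> int (2 * R + 1)" "\<bar>t\<bar> \<le> int (2 * D + 1)"
    "\<And>a. a \<in> A \<Longrightarrow> 0 < m * S K a + a k * t"
proof -
  define P where "P = {a\<in>A. 0 < a k}"
  define N where "N = {a\<in>A. a k < 0}"
  have split: "a k = 0 \<or> a \<in> P \<or> a \<in> N" if "a \<in> A" for a
    using that by (auto simp: P_def N_def)
  have large: "0 < S K a + g * t" if "a \<in> A" "g * t \<ge> int D + 1" for a g t
    using S[OF that(1)] that(2) by linarith
  consider "P = {}" | "N = {}" | "P \<noteq> {}" "N \<noteq> {}" by blast
  then show thesis
  proof cases
    case 1
    \<comment> \<open>Only upper bounds for the variable: a sufficiently negative value will do.\<close>
    have "0 < 1 * S K a + a k * (- (int D + 1))" if a: "a \<in> A" for a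
    proof (cases "a k = 0")
      case False
      with 1 split[OF a] have "a k < 0" by (auto simp: N_def)
      then have "1 * (int D + 1) \<le> (- a k) * (int D + 1)"
        by (intro mult_right_mono) auto
      then have "int D + 1 \<le> a k * (- (int D + 1))"
        by (simp only: mult_minus_left mult_minus_right mult_1)
      then show ?thesis using large[OF a] by simp
    qed (use zero a in auto)
    then show thesis using that[of 1 "- (int D + 1)"] by simp
  next
    case 2
    have "0 < 1 * S K a + a k * (int D + 1)" if a: "a \<in> A" for a
    proof (cases "a k = 0")
      case False
      with 2 split[OF a] have "0 < a k" by (auto simp: P_def)
      then have "1 * (int D + 1) \<le> a k * (int D + 1)"
        by (intro mult_right_mono) auto
      then have "int D + 1 \<le> a k * (int D + 1)" by simp
      then show ?thesis using large[OF a] by simp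
    qed (use zero a in auto)
    then show thesis using that[of 1 "int D + 1"] by simp
  next
    case 3
    have fin: "finite P" "finite N" using A by (auto simp: P_def N_def)
    obtain a where a: "a \<in> P" "\<And>a'. a' \<in> P \<Longrightarrow> S K a * a' k \<le> S K a' * a k"
    proof (rule minimal_ratio[where S = "S K" and D = "\<lambda>a. a k", OF fin(1) 3(1)])
      show "0 < a k" if "a \<in> P" for a using that by (simp add: P_def)
    qed blast
    obtain b where b: "b \<in> N" "\<And>b'. b' \<in> N \<Longrightarrow> S K b * (- b' k) \<le> S K b' * (- b k)"
    proof (rule minimal_ratio[where S = "S K" and D = "\<lambda>a. - a k", OF fin(2) 3(2)])
      show "0 < - a k" if "a \<in> N" for a using that by (simp add: N_def)
    qed blast
    have ab: "a \<in> A" "b \<in> A" "0 < a k" "0 < - b k"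
      using a(1) b(1) by (auto simp: P_def N_def)
    have pr: "0 < (- b k) * S K a + a k * S K b"
      using pair[OF ab(1,2)] ab by simp
    \<comment> \<open>The mediant of the largest lower bound and the smallest upper bound for the eliminated variable.\<close>
    have "0 < (a k + - b k) * S K a' + a' k * (S K b - S K a)" if a': "a' \<in> A" for a'
    proof -
      consider "a' k = 0" | "a' \<in> P" | "a' \<in> N" using split[OF a'] by blast
      then show ?thesis
      proof cases
        case 1
        then show ?thesis using zero[OF a' 1] ab by simp
      next
        case 2
        have "a' k * S K a \<le> a k * S K a'" using a(2)[OF 2] by (simp only: mult.commute)
        moreover have "0 < a' k" using 2 by (simp add: P_def)
        ultimately show ?thesis
          using strict_between_combination[OF pr ab(3,4)] by blast
      next
        case 3
        have "0 < a k * S K b + (- b k) * S K a" using pr by (simp only: add.commute)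
        moreover have "(- a' k) * S K b \<le> (- b k) * S K a'"
          using b(2)[OF 3] by (simp only: mult.commute)
        moreover have "0 < - a' k" using 3 by (simp add: N_def)
        ultimately have "0 < (- b k + a k) * S K a' + (- a' k) * (S K a - S K b)"
          using strict_between_combination ab(3,4) by blast
        then show ?thesis by (simp add: algebra_simps)
      qed
    qed
    then show thesis
      using that[of "a k + - b k" "S K b - S K a"] ab A(2)[OF ab(1)] A(2)[OF ab(2)]
        S[OF ab(1)] S[OF ab(2)] by simp
  qed
qed

text \<open>By induction on the set of variables. Eliminating a variable combines two inequalities with
  multipliers of size \<open>R\<close>, so the coefficients grow to at most \<open>2 * R\<^sup>2\<close>; the summand \<open>R\<close> in
  the polynomial \<open>[:0, 1, 2:]\<close> accounts for the inequalities that are kept. The degree of \<open>q\<close> is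
  exponential in the number of variables, which does not matter because \<open>q\<close> depends on nothing else.\<close>

lemma strict_inequalities_small_integer_solution:
  fixes K :: "'d set"
  assumes "finite K"
  shows "\<exists>q :: nat poly. \<forall>R (A :: ('d \<Rightarrow> int) set) (x :: 'd \<Rightarrow> real).
    finite A \<longrightarrow> (\<forall>a\<in>A. \<forall>k\<in>K. \<bar>a k\<bar> \<le> int R) \<longrightarrow>
    (\<forall>a\<in>A. 0 < (\<Sum>k\<in>K. real_of_int (a k) * x k)) \<longrightarrow>
    (\<exists>c :: 'd \<Rightarrow> int. (\<forall>k\<in>K. \<bar>c k\<bar> \<le> int (poly q R)) \<and> (\<forall>a\<in>A. 0 < (\<Sum>k\<in>K. a k * c k)))"
  using assms
proof (induction K)
  case empty
  then show ?case by auto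
next
  case (insert k K)
  from insert.IH obtain q :: "nat poly" where
    q: "\<forall>R (A :: ('d \<Rightarrow> int) set) (x :: 'd \<Rightarrow> real).
    finite A \<longrightarrow> (\<forall>a\<in>A. \<forall>k\<in>K. \<bar>a k\<bar> \<le> int R) \<longrightarrow>
    (\<forall>a\<in>A. 0 < (\<Sum>k\<in>K. real_of_int (a k) * x k)) \<longrightarrow>
    (\<exists>c :: 'd \<Rightarrow> int. (\<forall>k\<in>K. \<bar>c k\<bar> \<le> int (poly q R)) \<and> (\<forall>a\<in>A. 0 < (\<Sum>k\<in>K. a k * c k)))"
    by (elim exE)
  define Q :: "nat poly" where "Q = pcompose q [:0, 1, 2:]"
  define Dp :: "nat poly" where "Dp = [:0, card K:] * Q"
  show ?case
  proof (intro exI[of _ "[:1, 2:] * Q + 2 * Dp + 1"] allI impI)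
    fix R and A :: "('d \<Rightarrow> int) set" and x :: "'d \<Rightarrow> real"
    assume fin: "finite A" and R: "\<forall>a\<in>A. \<forall>l\<in>insert k K. \<bar>a l\<bar> \<le> int R"
      and x: "\<forall>a\<in>A. 0 < (\<Sum>l\<in>insert k K. real_of_int (a l) * x l)"
    \<comment> \<open>The positive combination of \<open>a\<close> and \<open>b\<close> in which the variable \<open>k\<close> cancels.\<close>
    define comb :: "('d \<Rightarrow> int) \<Rightarrow> ('d \<Rightarrow> int) \<Rightarrow> 'd \<Rightarrow> int" where
      "comb = (\<lambda>a b l. a k * b l - b k * a l)"
    define A' where "A' = {a\<in>A. a k = 0} \<union> (\<lambda>(a, b). comb a b) ` ({a\<in>A. 0 < a k} \<times> {a\<in>A. a k < 0})"
    have x': "0 < (\<Sum>l\<in>K. real_of_int (a l) * x l) + real_of_int (a k) * x k" if "a \<in> A" for a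
      using x that insert.hyps by (auto simp: add.commute)
    have "\<exists>c :: 'd \<Rightarrow> int. (\<forall>l\<in>K. \<bar>c l\<bar> \<le> int (poly q (R + 2 * R * R))) \<and>
        (\<forall>a\<in>A'. 0 < (\<Sum>l\<in>K. a l * c l))"
    proof (rule q[THEN spec, THEN spec, THEN spec, THEN mp, THEN mp, THEN mp])
      show "finite A'" using fin by (auto simp: A'_def)
      show "\<forall>a\<in>A'. \<forall>l\<in>K. \<bar>a l\<bar> \<le> int (R + 2 * R * R)"
      proof (intro ballI)
        fix a l assume "a \<in> A'" and l: "l \<in> K"
        then consider "a \<in> A" | a1 a2 where "a1 \<in> A" "a2 \<in> A" "a = comb a1 a2"
          by (auto simp: A'_def)
        then show "\<bar>a l\<bar> \<le> int (R + 2 * R * R)"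
        proof cases
          case 1
          then have "\<bar>a l\<bar> \<le> int R" using R l by blast
          then show ?thesis by (simp add: add_increasing2)
        next
          case 2
          have "\<bar>a1 k * a2 l\<bar> \<le> int R * int R" "\<bar>a2 k * a1 l\<bar> \<le> int R * int R"
            unfolding abs_mult using R 2 l by (auto intro!: mult_mono)
          then have "\<bar>a l\<bar> \<le> 2 * (int R * int R)"
            unfolding 2(3) comb_def by linarith
          then show ?thesis by simp
        qed
      qed
      show "\<forall>a\<in>A'. 0 < (\<Sum>l\<in>K. real_of_int (a l) * x l)"
      proof
        fix a assume "a \<in> A'"
        then consider "a \<in> A" "a k = 0"
          | a1 a2 where "a1 \<in> A" "a2 \<in> A" "a = comb a1 a2" "0 < a1 k" "a2 k < 0"
          by (auto simp: A'_def)
        then show "0 < (\<Sum>l\<in>K. real_of_int (a l) * x l)"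
        proof cases
          case 1
          then show ?thesis using x'[OF 1(1)] by simp
        next
          case 2
          let ?S = "\<lambda>a. \<Sum>l\<in>K. real_of_int (a l) * x l"
          have "0 < real_of_int (a1 k) * (?S a2 + real_of_int (a2 k) * x k)
              + real_of_int (- a2 k) * (?S a1 + real_of_int (a1 k) * x k)"
            using x'[OF 2(1)] x'[OF 2(2)] 2 by (intro add_pos_pos[OF mult_pos_pos mult_pos_pos]) auto
          also have "\<dots> = real_of_int (a1 k) * ?S a2 - real_of_int (a2 k) * ?S a1"
            by (simp add: algebra_simps)
          also have "\<dots> = ?S a"
            unfolding 2(3) comb_def
            by (simp add: sum_distrib_left sum_subtractf left_diff_distrib mult.assoc)
          finally show ?thesis .
        qed
      qed
    qed
    moreover have PQ: "poly q (R + 2 * R * R) = poly Q R"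
      by (simp add: Q_def poly_pcompose algebra_simps mult_2_right)
    ultimately obtain c' :: "'d \<Rightarrow> int" where c': "\<And>l. l \<in> K \<Longrightarrow> \<bar>c' l\<bar> \<le> int (poly Q R)"
      and pos: "\<And>a. a \<in> A' \<Longrightarrow> 0 < (\<Sum>l\<in>K. a l * c' l)"
      unfolding PQ by blast
    let ?S = "\<lambda>a. \<Sum>l\<in>K. a l * c' l"
    have S: "\<bar>?S a\<bar> \<le> int (poly Dp R)" if "a \<in> A" for a
    proof -
      have "\<bar>?S a\<bar> \<le> (\<Sum>l\<in>K. int R * int (poly Q R))"
        using R c' that by (intro order_trans[OF sum_abs] sum_mono)
          (auto simp: abs_mult intro!: mult_mono)
      then show ?thesis by (simp add: Dp_def algebra_simps)
    qed
    have zero: "0 < ?S a" if "a \<in> A" "a k = 0" for a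
      using that pos by (auto simp: A'_def)
    have pair: "0 < a k * ?S b - b k * ?S a" if "a \<in> A" "b \<in> A" "0 < a k" "b k < 0" for a b
    proof -
      have "0 < ?S (comb a b)" using that pos by (auto simp: A'_def)
      then show ?thesis
        by (simp add: comb_def sum_distrib_left sum_subtractf left_diff_distrib mult.assoc)
    qed
    obtain m t where mt: "0 < m" "m \<le> int (2 * R + 1)" "\<bar>t\<bar> \<le> int (2 * poly Dp R + 1)"
      "\<And>a. a \<in> A \<Longrightarrow> 0 < m * ?S a + a k * t"
    proof (rule strict_inequalities_elim_var[OF insert.hyps fin _ S zero pair])
      show "\<bar>a k\<bar> \<le> int R" if "a \<in> A" for a using R that by blast
    qed auto
    show "\<exists>c :: 'd \<Rightarrow> int. (\<forall>l\<in>insert k K. \<bar>c l\<bar> \<le> int (poly ([:1, 2:] * Q + 2 * Dp + 1) R)) \<and>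
        (\<forall>a\<in>A. 0 < (\<Sum>l\<in>insert k K. a l * c l))"
    proof (intro exI[of _ "\<lambda>l. if l = k then t else m * c' l"] conjI ballI)
      fix l assume l: "l \<in> insert k K"
      show "\<bar>if l = k then t else m * c' l\<bar> \<le> int (poly ([:1, 2:] * Q + 2 * Dp + 1) R)"
      proof (cases "l = k")
        case True
        then have "\<bar>if l = k then t else m * c' l\<bar> \<le> int (2 * poly Dp R + 1)"
          using mt(3) by simp
        also have "\<dots> \<le> int (poly ([:1, 2:] * Q + 2 * Dp + 1) R)"
          unfolding of_nat_le_iff by simp
        finally show ?thesis .
      next
        case False
        then have "\<bar>m * c' l\<bar> \<le> int (2 * R + 1) * int (poly Q R)"
          unfolding abs_mult using mt(1,2) c' l by (intro mult_mono) auto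
        then show ?thesis using False by (simp add: algebra_simps)
      qed
    next
      fix a assume "a \<in> A"
      have "(\<Sum>l\<in>insert k K. a l * (if l = k then t else m * c' l))
          = a k * t + (\<Sum>l\<in>K. a l * (if l = k then t else m * c' l))"
        using insert.hyps by simp
      also have "(\<Sum>l\<in>K. a l * (if l = k then t else m * c' l)) = m * ?S a"
        unfolding sum_distrib_left using insert.hyps by (intro sum.cong) auto
      finally show "0 < (\<Sum>l\<in>insert k K. a l * (if l = k then t else m * c' l))"
        using mt(4)[OF \<open>a \<in> A\<close>] by simp
    qed
  qed
qed

section \<open>A convex function is maximised at a point exposed by a small integer functional\<close>

text \<open>A convex function on a polytope is maximised at an extreme point \<open>v\<close>, and an extreme point is
  separated from the convex hull of the remaining points.\<close>

lemma convex_max_exposed: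
  fixes S :: "'a::euclidean_space set"
  assumes "finite S" and "S \<noteq> {}" and "convex_on UNIV f"
  obtains v x where "v \<in> S" and "\<And>u. u \<in> S \<Longrightarrow> f u \<le> f v"
    and "\<And>u. u \<in> S \<Longrightarrow> u \<noteq> v \<Longrightarrow> inner x u < inner x v"
proof -
  let ?E = "{v. v extreme_point_of (convex hull S)}"
  have E: "?E \<subseteq> S" by (auto dest: extreme_point_of_convex_hull)
  have hull: "convex hull S = convex hull ?E"
    by (rule Krein_Milman_polytope[OF assms(1)])
  have "finite ?E" using E assms(1) by (rule finite_subset)
  moreover have "?E \<noteq> {}" using hull assms(2) by (metis convex_hull_eq_empty)
  ultimately obtain v where v: "v \<in> ?E" "\<And>u. u \<in> ?E \<Longrightarrow> f u \<le> f v"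
    using arg_min_if_finite[of ?E "\<lambda>u. - f u"] by (metis neg_less_iff_less not_less)
  have "convex_on (convex hull ?E) f"
    by (rule convex_on_subset[OF assms(3)]) (auto intro: convex_convex_hull)
  then have max: "f u \<le> f v" if "u \<in> S" for u
    using convex_on_convex_hull_bound[of ?E f "f v"] v(2) hull_inc[OF that, of convex] hull by auto
  have "v \<notin> convex hull (S - {v})"
  proof
    assume "v \<in> convex hull (S - {v})"
    moreover have "convex (convex hull S - {v})"
      using v(1) by (simp add: extreme_point_of_stillconvex)
    then have "convex hull (S - {v}) \<subseteq> convex hull S - {v}"
      by (intro hull_minimal) (auto intro: hull_inc)
    ultimately show False by blast
  qed
  moreover have "closed (convex hull (S - {v}))"
    using assms(1) by (simp add: compact_imp_closed finite_imp_compact_convex_hull)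
  ultimately obtain x b where xb: "inner x v < b" "\<And>u. u \<in> convex hull (S - {v}) \<Longrightarrow> b < inner x u"
    using separating_hyperplane_closed_point[of "convex hull (S - {v})" v] by auto
  have "inner (- x) u < inner (- x) v" if "u \<in> S" "u \<noteq> v" for u
  proof -
    have "u \<in> convex hull (S - {v})" using that by (intro hull_inc) auto
    from xb(2)[OF this] xb(1) show ?thesis by simp
  qed
  with v(1) E max show thesis using that by blast
qed

text \<open>The exposing functional of the preceding lemma, made integral and small. The differences \<open>v - u\<close> have
  entries of size at most \<open>2 * R\<close>.\<close>

lemma convex_max_small_functional:
  obtains q :: "nat poly" where
    "\<And>R (S :: ('d::finite \<Rightarrow> int) set) (f :: real ^ 'd \<Rightarrow> real).
       finite S \<Longrightarrow> S \<noteq> {} \<Longrightarrow> convex_on UNIV f \<Longrightarrow> (\<And>u k. u \<in> S \<Longrightarrow> \<bar>u k\<bar> \<le> int R) \<Longrightarrow>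
       \<exists>v\<in>S. \<exists>c. (\<forall>u\<in>S. f (\<chi> k. real_of_int (u k)) \<le> f (\<chi> k. real_of_int (v k))) \<and>
         (\<forall>k. \<bar>c k\<bar> \<le> int (poly q (2 * R))) \<and>
         (\<forall>u\<in>S. u \<noteq> v \<longrightarrow> (\<Sum>k\<in>UNIV. c k * u k) < (\<Sum>k\<in>UNIV. c k * v k))"
proof -
  obtain q :: "nat poly" where
    q: "\<forall>R (A :: ('d \<Rightarrow> int) set) (x :: 'd \<Rightarrow> real).
    finite A \<longrightarrow> (\<forall>a\<in>A. \<forall>k\<in>UNIV. \<bar>a k\<bar> \<le> int R) \<longrightarrow>
    (\<forall>a\<in>A. 0 < (\<Sum>k\<in>UNIV. real_of_int (a k) * x k)) \<longrightarrow>
    (\<exists>c :: 'd \<Rightarrow> int. (\<forall>k\<in>UNIV. \<bar>c k\<bar> \<le> int (poly q R)) \<and> (\<forall>a\<in>A. 0 < (\<Sum>k\<in>UNIV. a k * c k)))"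
    using strict_inequalities_small_integer_solution[OF finite_class.finite_UNIV] by (elim exE)
  show thesis
  proof (rule that[of q])
    fix R and S :: "('d \<Rightarrow> int) set" and f :: "real ^ 'd \<Rightarrow> real"
    assume S: "finite S" "S \<noteq> {}" and f: "convex_on UNIV f"
      and R: "\<And>u k. u \<in> S \<Longrightarrow> \<bar>u k\<bar> \<le> int R"
    define emb :: "('d \<Rightarrow> int) \<Rightarrow> real ^ 'd" where "emb = (\<lambda>u. \<chi> k. real_of_int (u k))"
    have inj: "emb u \<noteq> emb v" if "u \<noteq> v" for u v
      using that by (auto simp: emb_def vec_eq_iff fun_eq_iff)
    obtain p x where p: "p \<in> emb ` S" "\<And>u. u \<in> emb ` S \<Longrightarrow> f u \<le> f p"
      "\<And>u. u \<in> emb ` S \<Longrightarrow> u \<noteq> p \<Longrightarrow> inner x u < inner x p"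
    proof (rule convex_max_exposed[OF _ _ f])
      show "finite (emb ` S)" "emb ` S \<noteq> {}" using S by auto
    qed blast
    from p(1) obtain v where "v \<in> S" and pv: "p = emb v" by blast
    have v: "f (emb u) \<le> f (emb v)" if "u \<in> S" for u
      using p(2)[of "emb u"] that pv by simp
    have x: "inner x (emb u) < inner x (emb v)" if "u \<in> S" "u \<noteq> v" for u
      using p(3)[of "emb u"] inj[OF that(2)] that pv by simp
    let ?A = "(\<lambda>u k. v k - u k) ` (S - {v})"
    have "\<exists>c :: 'd \<Rightarrow> int. (\<forall>k\<in>UNIV. \<bar>c k\<bar> \<le> int (poly q (2 * R))) \<and>
      (\<forall>a\<in>?A. 0 < (\<Sum>k\<in>UNIV. a k * c k))"
    proof (rule q[THEN spec, THEN spec, THEN spec, THEN mp, THEN mp, THEN mp])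
      show "finite ?A" using S by simp
      show "\<forall>a\<in>?A. \<forall>k\<in>UNIV. \<bar>a k\<bar> \<le> int (2 * R)"
      proof safe
        fix u k assume "u \<in> S"
        then show "\<bar>v k - u k\<bar> \<le> int (2 * R)"
          using R[of u k] R[OF \<open>v \<in> S\<close>, of k] by simp
      qed
      show "\<forall>a\<in>?A. 0 < (\<Sum>k\<in>UNIV. real_of_int (a k) * x $ k)"
      proof
        fix a assume "a \<in> ?A"
        then obtain u where u: "u \<in> S" "u \<noteq> v" and a: "a = (\<lambda>k. v k - u k)" by blast
        then have "inner x (emb u) < inner x (emb v)" using x by blast
        then show "0 < (\<Sum>k\<in>UNIV. real_of_int (a k) * x $ k)"
          by (simp add: a inner_vec_def emb_def sum_subtractf algebra_simps)
      qed
    qed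
    then obtain c where c: "\<forall>k. \<bar>c k\<bar> \<le> int (poly q (2 * R))"
      "\<And>u. u \<in> S - {v} \<Longrightarrow> 0 < (\<Sum>k\<in>UNIV. (v k - u k) * c k)" by auto
    have "(\<Sum>k\<in>UNIV. c k * u k) < (\<Sum>k\<in>UNIV. c k * v k)" if "u \<in> S" "u \<noteq> v" for u
      using c(2)[of u] that by (simp add: sum_subtractf algebra_simps)
    with v c(1) show "\<exists>v\<in>S. \<exists>c. (\<forall>u\<in>S. f (\<chi> k. real_of_int (u k)) \<le> f (\<chi> k. real_of_int (v k))) \<and>
         (\<forall>k. \<bar>c k\<bar> \<le> int (poly q (2 * R))) \<and>
         (\<forall>u\<in>S. u \<noteq> v \<longrightarrow> (\<Sum>k\<in>UNIV. c k * u k) < (\<Sum>k\<in>UNIV. c k * v k))"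
      by - (rule bexI[OF exI[of _ c] \<open>v \<in> S\<close>], simp add: emb_def)
  qed
qed

section \<open>The auction algorithm for the linear assignment problem\<close>

text \<open>
  Persons and objects are numbered from \<open>1\<close>, and \<open>0\<close> means that there is no owner or no assigned object.
  The last conjunct is complementary slackness up to \<open>1\<close>: an assigned person could gain at
  most one unit of profit by switching to another object at current prices.
\<close>

definition auction_inv ::
  "int \<Rightarrow> int \<Rightarrow> (int \<Rightarrow> int \<Rightarrow> int) \<Rightarrow> (int \<Rightarrow> int) \<Rightarrow> (int \<Rightarrow> int) \<Rightarrow> (int \<Rightarrow> int) \<Rightarrow> bool" where
  "auction_inv n A a price owner asg \<longleftrightarrow>
     (\<forall>j\<in>{1..n}. 0 \<le> price j \<and> price j \<le> 2 * A + 1 \<and>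
        (owner j = 0 \<longrightarrow> price j = 0) \<and>
        (owner j \<noteq> 0 \<longrightarrow> owner j \<in> {1..n} \<and> asg (owner j) = j)) \<and>
     (\<forall>i\<in>{1..n}. asg i \<noteq> 0 \<longrightarrow> asg i \<in> {1..n} \<and> owner (asg i) = i \<and>
        (\<forall>j\<in>{1..n}. a i j - price j \<le> a i (asg i) - price (asg i) + 1))"

text \<open>If all objects were owned, the owners would be \<open>n\<close> distinct persons, so everybody would be assigned.\<close>

lemma auction_free_object:
  assumes "auction_inv n A a price owner asg" and "i \<in> {1..n}" and "asg i = 0"
  shows "\<exists>j\<in>{1..n}. owner j = 0"
proof (rule ccontr)
  assume "\<not> ?thesis"
  then have own: "owner j \<in> {1..n} \<and> asg (owner j) = j" if "j \<in> {1..n}" for j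
    using assms(1) that by (auto simp: auction_inv_def)
  then have "inj_on owner {1..n}"
    by (metis inj_onI)
  moreover have "owner ` {1..n} \<subseteq> {1..n}" using own by blast
  ultimately have "owner ` {1..n} = {1..n}"
    by (intro endo_inj_surj) auto
  then obtain j where "j \<in> {1..n}" "owner j = i" using assms(2) by (metis imageE)
  with own[of j] assms(2,3) show False by auto
qed

text \<open>Complementary slackness survives because prices never decrease, and person \<open>i\<close> pays only one unit more
  than the price at which \<open>b\<close> was a best choice. The price bound survives because \<open>b\<close> is at least
  as profitable as some free object, whose price is \<open>0\<close>.

  The previous owner becomes unassigned. If there is none, \<open>owner b\<close> is \<open>0\<close>, and the update at \<open>0\<close>
  is harmless because no person has that number.\<close>

lemma auction_bid:
  assumes inv: "auction_inv n A a price owner asg" and i: "i \<in> {1..n}" "asg i = 0"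
    and A: "\<And>i j. i \<in> {1..n} \<Longrightarrow> j \<in> {1..n} \<Longrightarrow> \<bar>a i j\<bar> \<le> A"
    and b: "b \<in> {1..n}" "\<And>j. j \<in> {1..n} \<Longrightarrow> a i j - price j \<le> a i b - price b"
  shows "auction_inv n A a (price(b := price b + 1)) (owner(b := i)) (asg(owner b := 0, i := b))"
proof -
  obtain j0 where j0: "j0 \<in> {1..n}" "owner j0 = 0"
    using auction_free_object[OF inv i] by blast
  then have "price j0 = 0" using inv by (auto simp: auction_inv_def)
  then have pb: "price b \<le> 2 * A"
    using b(2)[OF j0(1)] A[OF i(1) j0(1)] A[OF i(1) b(1)] by linarith
  have ij: "owner j \<noteq> i" if "j \<in> {1..n}" for j
    using inv that i by (auto simp: auction_inv_def)
  show ?thesis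
    unfolding auction_inv_def
  proof (intro conjI ballI)
    fix j assume j: "j \<in> {1..n}"
    have *: "0 \<le> price j" "price j \<le> 2 * A + 1" "owner j = 0 \<longrightarrow> price j = 0"
      "owner j \<noteq> 0 \<longrightarrow> owner j \<in> {1..n} \<and> asg (owner j) = j"
      using inv j by (auto simp: auction_inv_def)
    show "0 \<le> (price(b := price b + 1)) j" "(price(b := price b + 1)) j \<le> 2 * A + 1"
      using * pb by auto
    show "(owner(b := i)) j = 0 \<longrightarrow> (price(b := price b + 1)) j = 0"
      using * i by auto
    show "(owner(b := i)) j \<noteq> 0 \<longrightarrow> (owner(b := i)) j \<in> {1..n} \<and>
        (asg(owner b := 0, i := b)) ((owner(b := i)) j) = j"
    proof (cases "j = b")
      case True
      then show ?thesis using i by simp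
    next
      case False
      moreover have "owner j \<noteq> 0 \<longrightarrow> owner j \<noteq> owner b"
        using * False inv b(1) by (auto simp: auction_inv_def)
      ultimately show ?thesis using * ij[OF j] by auto
    qed
  next
    fix i' assume i': "i' \<in> {1..n}"
    have *: "asg i' \<noteq> 0 \<longrightarrow> asg i' \<in> {1..n} \<and> owner (asg i') = i' \<and>
        (\<forall>j\<in>{1..n}. a i' j - price j \<le> a i' (asg i') - price (asg i') + 1)"
      using inv i' by (auto simp: auction_inv_def)
    show "(asg(owner b := 0, i := b)) i' \<noteq> 0 \<longrightarrow> (asg(owner b := 0, i := b)) i' \<in> {1..n} \<and>
        (owner(b := i)) ((asg(owner b := 0, i := b)) i') = i' \<and>
        (\<forall>j\<in>{1..n}. a i' j - (price(b := price b + 1)) j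
           \<le> a i' ((asg(owner b := 0, i := b)) i') - (price(b := price b + 1)) ((asg(owner b := 0, i := b)) i') + 1)"
    proof (cases "i' = i")
      case True
      have "a i j - (price(b := price b + 1)) j \<le> a i b - price b" if "j \<in> {1..n}" for j
        using b(2)[OF that] by auto
      then show ?thesis using True b(1) by simp
    next
      case False
      show ?thesis
      proof (cases "i' = owner b \<or> asg i' = 0")
        case True
        then show ?thesis using False by auto
      next
        case F: False
        then have "asg i' \<noteq> b" using * by auto
        then show ?thesis using * F False by fastforce
      qed
    qed
  qed
qed

lemma auction_sum_price:
  assumes "auction_inv n A a price owner asg" and "0 \<le> n"
  shows "(\<Sum>j\<in>{1..n}. price j) \<le> n * (2 * A + 1)"
proof -
  have "(\<Sum>j\<in>{1..n}. price j) \<le> (\<Sum>j\<in>{1..n}. 2 * A + 1)"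
    using assms by (intro sum_mono) (auto simp: auction_inv_def)
  then show ?thesis using assms(2) by simp
qed

text \<open>Summing complementary slackness over all persons shows that no assignment \<open>\<tau>\<close> beats \<open>asg\<close> by more than
  \<open>n\<close>, as the prices cancel. Since all gains are multiples of \<open>n + 1\<close>, it does not beat \<open>asg\<close> at all.\<close>

lemma auction_optimal:
  assumes inv: "auction_inv n A (\<lambda>i j. (n + 1) * a i j) price owner asg" and n: "0 \<le> n"
    and asg: "\<And>i. i \<in> {1..n} \<Longrightarrow> asg i \<noteq> 0"
  shows "bij_betw asg {1..n} {1..n}"
    and "bij_betw \<tau> {1..n} {1..n} \<Longrightarrow> (\<Sum>i\<in>{1..n}. a i (\<tau> i)) \<le> (\<Sum>i\<in>{1..n}. a i (asg i))"
proof -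
  have *: "asg i \<in> {1..n} \<and> owner (asg i) = i \<and>
      (\<forall>j\<in>{1..n}. (n + 1) * a i j - price j \<le> (n + 1) * a i (asg i) - price (asg i) + 1)"
    if "i \<in> {1..n}" for i
    using inv asg[OF that] that by (auto simp: auction_inv_def)
  then have "inj_on asg {1..n}" by (metis inj_onI)
  moreover have "asg ` {1..n} \<subseteq> {1..n}" using * by blast
  ultimately show bij: "bij_betw asg {1..n} {1..n}"
    unfolding bij_betw_def by (intro conjI endo_inj_surj) auto
  assume \<tau>: "bij_betw \<tau> {1..n} {1..n}"
  let ?s = "\<lambda>\<sigma>. \<Sum>i\<in>{1..n}. a i (\<sigma> i)"
  have price: "(\<Sum>i\<in>{1..n}. price (\<sigma> i)) = (\<Sum>j\<in>{1..n}. price j)" if "bij_betw \<sigma> {1..n} {1..n}" for \<sigma>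
    using that by (rule sum.reindex_bij_betw)
  have "(\<Sum>i\<in>{1..n}. (n + 1) * a i (\<tau> i) - price (\<tau> i))
      \<le> (\<Sum>i\<in>{1..n}. (n + 1) * a i (asg i) - price (asg i) + 1)"
    using * bij_betwE[OF \<tau>] by (intro sum_mono) blast
  then have "(n + 1) * ?s \<tau> \<le> (n + 1) * ?s asg + n"
    using n price[OF \<tau>] price[OF bij] by (simp add: sum.distrib sum_subtractf sum_distrib_left)
  then have "(n + 1) * (?s \<tau> - ?s asg) < (n + 1) * 1"
    by (simp add: right_diff_distrib)
  moreover have "0 < n + 1" using n by simp
  ultimately have "?s \<tau> - ?s asg < 1"
    using mult_less_cancel_left_pos by blast
  then show "?s \<tau> \<le> ?s asg" by simp
qed

section \<open>Perfect matchings as permutations\<close>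

text \<open>Permutations act on integers since integers are what registers are addressed with and contain. Their
  values outside the range are arbitrary: a permutation is going to be an array of the program.\<close>

definition perms :: "nat \<Rightarrow> (int \<Rightarrow> int) set" where
  "perms n = {\<sigma>. bij_betw \<sigma> {1..int n} {1..int n}}"

definition matching_of :: "nat \<Rightarrow> (int \<Rightarrow> int) \<Rightarrow> (nat \<times> nat) set" where
  "matching_of n \<sigma> = (\<lambda>i. (nat i, nat (\<sigma> i))) ` {1..int n}"

lemma perms_range: "\<sigma> \<in> perms n \<Longrightarrow> i \<in> {1..int n} \<Longrightarrow> \<sigma> i \<in> {1..int n}"
  by (auto simp: perms_def dest: bij_betwE)

lemma matching_of_iff:
  assumes "\<sigma> \<in> perms n"
  shows "(i, j) \<in> matching_of n \<sigma> \<longleftrightarrow> (i, j) \<in> edges n \<and> \<sigma> (int i) = int j"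
proof
  assume "(i, j) \<in> matching_of n \<sigma>"
  then obtain i' where i': "i' \<in> {1..int n}" "i = nat i'" "j = nat (\<sigma> i')"
    by (auto simp: matching_of_def)
  then show "(i, j) \<in> edges n \<and> \<sigma> (int i) = int j"
    using perms_range[OF assms i'(1)] by (auto simp: edges_def)
next
  assume "(i, j) \<in> edges n \<and> \<sigma> (int i) = int j"
  then show "(i, j) \<in> matching_of n \<sigma>"
    by (force simp: matching_of_def edges_def image_iff intro!: bexI[of _ "int i"])
qed

lemma perfect_matching_of:
  assumes "\<sigma> \<in> perms n"
  shows "perfect_matching n (matching_of n \<sigma>)"
  unfolding perfect_matching_def
proof (intro conjI ballI subsetI)
  fix e assume "e \<in> matching_of n \<sigma>"
  then show "e \<in> edges n"
    using matching_of_iff[OF assms] by (cases e) auto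
next
  fix i assume i: "i \<in> {1..n}"
  show "\<exists>!j. (i, j) \<in> matching_of n \<sigma>"
  proof (rule ex1I[of _ "nat (\<sigma> (int i))"])
    show "(i, nat (\<sigma> (int i))) \<in> matching_of n \<sigma>"
      using i perms_range[OF assms, of "int i"] by (auto simp: matching_of_iff[OF assms] edges_def)
  qed (auto simp: matching_of_iff[OF assms])
next
  fix j assume j: "j \<in> {1..n}"
  have b: "bij_betw \<sigma> {1..int n} {1..int n}" using assms by (simp add: perms_def)
  then have "int j \<in> \<sigma> ` {1..int n}" using j by (auto simp: bij_betw_def)
  then obtain i where i: "i \<in> {1..int n}" "\<sigma> i = int j" by auto
  show "\<exists>!i. (i, j) \<in> matching_of n \<sigma>"
  proof (rule ex1I[of _ "nat i"])
    show "(nat i, j) \<in> matching_of n \<sigma>"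
      using i j by (auto simp: matching_of_iff[OF assms] edges_def)
    fix i' assume "(i', j) \<in> matching_of n \<sigma>"
    then have i': "int i' \<in> {1..int n}" "\<sigma> (int i') = \<sigma> i"
      using i by (auto simp: matching_of_iff[OF assms] edges_def)
    then have "int i' = i"
      using b i(1) by (meson bij_betw_def inj_onD)
    then show "i' = nat i" by simp
  qed
qed

lemma perfect_matchingE:
  assumes "perfect_matching n M"
  obtains \<sigma> where "\<sigma> \<in> perms n" and "M = matching_of n \<sigma>"
proof -
  note M = assms[unfolded perfect_matching_def]
  define \<sigma> where "\<sigma> = (\<lambda>i. int (THE j. (nat i, j) \<in> M))"
  have the: "(nat i, nat (\<sigma> i)) \<in> M" if "i \<in> {1..int n}" for i
  proof -
    have "nat i \<in> {1..n}" using that by auto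
    then have "\<exists>!j. (nat i, j) \<in> M" using M by blast
    from theI'[OF this] show ?thesis by (simp add: \<sigma>_def)
  qed
  have nonneg: "0 \<le> \<sigma> i" for i by (simp add: \<sigma>_def)
  have "inj_on \<sigma> {1..int n}"
  proof (rule inj_onI)
    fix i i' assume *: "i \<in> {1..int n}" "i' \<in> {1..int n}" "\<sigma> i = \<sigma> i'"
    then have "(nat i, nat (\<sigma> i)) \<in> M" "(nat i', nat (\<sigma> i)) \<in> M" using the by metis+
    moreover from this have "nat (\<sigma> i) \<in> {1..n}" using M by (auto simp: edges_def)
    ultimately have "nat i = nat i'" using M by blast
    then show "i = i'" using * by auto
  qed
  moreover have "\<sigma> ` {1..int n} \<subseteq> {1..int n}"
  proof safe
    fix i assume "i \<in> {1..int n}"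
    from the[OF this] have "nat (\<sigma> i) \<in> {1..n}" using M by (auto simp: edges_def)
    then show "\<sigma> i \<in> {1..int n}" using nonneg[of i] by auto
  qed
  ultimately have \<sigma>: "\<sigma> \<in> perms n"
    unfolding perms_def bij_betw_def by (auto intro: endo_inj_surj[THEN equalityD2, THEN subsetD])
  have "M = matching_of n \<sigma>"
  proof (intro equalityI subsetI)
    fix e assume e: "e \<in> M"
    obtain i j where ij: "e = (i, j)" by (cases e)
    then have i: "i \<in> {1..n}" using e M by (auto simp: edges_def)
    then have "(i, nat (\<sigma> (int i))) \<in> M" using the[of "int i"] by simp
    then have "j = nat (\<sigma> (int i))" using e ij M i by blast
    then show "e \<in> matching_of n \<sigma>"
      using ij e M nonneg[of "int i"] by (auto simp: matching_of_iff[OF \<sigma>])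
  next
    fix e assume "e \<in> matching_of n \<sigma>"
    then show "e \<in> M" using the by (auto simp: matching_of_def)
  qed
  with \<sigma> show thesis using that by blast
qed

lemma sum_matching_of:
  "(\<Sum>e\<in>matching_of n \<sigma>. h e) = (\<Sum>i\<in>{1..int n}. h (nat i, nat (\<sigma> i)))"
  unfolding matching_of_def by (subst sum.reindex) (auto simp: inj_on_def)

section \<open>The program\<close>

text \<open>An enumeration of the dimensions, along which expressions and programs over all dimensions are unfolded.\<close>

definition dims :: "'d::finite list" where
  "dims = (SOME ks. distinct ks \<and> set ks = UNIV)"

lemma dims: "distinct (dims :: 'd::finite list)" "set (dims :: 'd list) = UNIV"
proof -
  have "\<exists>ks :: 'd list. distinct ks \<and> set ks = UNIV"
    using finite_distinct_list[of "UNIV :: 'd set"] by auto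
  from someI_ex[OF this] show "distinct (dims :: 'd::finite list)" "set (dims :: 'd list) = UNIV"
    by (auto simp: dims_def)
qed

definition sum_exp :: "('d::finite \<Rightarrow> 'd aexp) \<Rightarrow> 'd aexp" where
  "sum_exp h = foldr (\<lambda>k. Add (h k)) dims (Const 0)"

lemma aval_sum_exp [simp]: "aval (sum_exp h) s = (\<Sum>k\<in>UNIV. aval (h k) s)"
proof -
  have "aval (foldr (\<lambda>k. Add (h k)) ks (Const 0)) s = (\<Sum>k\<leftarrow>ks. aval (h k) s)" for ks
    by (induction ks) auto
  then show ?thesis
    by (simp add: sum_exp_def sum_list_distinct_conv_sum_set dims)
qed

text \<open>Horner's scheme.\<close>

definition poly_exp :: "nat poly \<Rightarrow> 'd aexp \<Rightarrow> 'd aexp" where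
  "poly_exp q e = foldr (\<lambda>c e'. Add (Const (int c)) (Mul e e')) (coeffs q) (Const 0)"

lemma aval_poly_exp:
  assumes "aval e s = int m"
  shows "aval (poly_exp q e) s = int (poly q m)"
proof (induction q)
  case 0
  then show ?case by (simp add: poly_exp_def)
next
  case (pCons a q)
  then have "coeffs (pCons a q) = a # coeffs q"
    by (auto simp: cCons_def)
  then show ?case
    using pCons assms by (simp add: poly_exp_def)
qed

text \<open>The work arrays of the program. The single loop variables and constants occupy position \<open>(0, 0)\<close> of their
  array, and vectors occupy row \<open>0\<close>. The prices, owners and assigned objects of the auction are in
  \<open>rPrice\<close>, \<open>rOwner\<close> and \<open>rAsg\<close>, the best matching found so far is in \<open>rBest\<close>, and \<open>rValAsg\<close> and
  \<open>rValBest\<close> receive the weight vectors of the two matchings to be compared. The coefficients of the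
  linear functional follow from number \<open>14\<close> on, each in an array of its own, so that they can be
  the loop variables of nested loops.\<close>

abbreviation (input) "rRadius \<equiv> 0 :: nat"
abbreviation (input) "rBox \<equiv> 1 :: nat"
abbreviation (input) "rRounds \<equiv> 2 :: nat"
abbreviation (input) "rI \<equiv> 3 :: nat"
abbreviation (input) "rJ \<equiv> 4 :: nat"
abbreviation (input) "rT \<equiv> 5 :: nat"
abbreviation (input) "rBid \<equiv> 6 :: nat"
abbreviation (input) "rPrice \<equiv> 7 :: nat"
abbreviation (input) "rOwner \<equiv> 8 :: nat"
abbreviation (input) "rAsg \<equiv> 9 :: nat"
abbreviation (input) "rBest \<equiv> 10 :: nat"
abbreviation (input) "rValAsg \<equiv> 11 :: nat"
abbreviation (input) "rValBest \<equiv> 12 :: nat"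
abbreviation (input) "rAnswer \<equiv> 13 :: nat"

definition rCoef :: "'d::finite \<Rightarrow> nat" where
  "rCoef k = 14 + to_nat k"

lemma rCoef_ge: "14 \<le> rCoef k"
  by (simp add: rCoef_def)

lemma rCoef_eq_iff [simp]: "rCoef k = rCoef l \<longleftrightarrow> k = l"
  by (simp add: rCoef_def)

abbreviation idx :: "'d::finite \<Rightarrow> int" where
  "idx k \<equiv> int (to_nat k)"

abbreviation cell :: "nat \<Rightarrow> 'd aexp \<Rightarrow> 'd aexp" where
  "cell m e \<equiv> Get (Work m) (Const 0) e"

abbreviation set_cell :: "nat \<Rightarrow> 'd aexp \<Rightarrow> 'd aexp \<Rightarrow> 'd prog" where
  "set_cell m e v \<equiv> Assign (Work m) (Const 0) e v"

abbreviation size_exp :: "'d aexp" where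
  "size_exp \<equiv> Get Dim (Const 0) (Const 0)"

text \<open>The sum of the squares of all weights bounds each of them, and needs no case distinction on signs.\<close>

definition prog_radius :: "'d::finite prog" where
  "prog_radius = For rI (Const 1) size_exp (For rJ (Const 1) size_exp
     (set_scalar rRadius (Add (scalar rRadius)
        (sum_exp (\<lambda>k. Mul (Get (Weight k) (scalar rI) (scalar rJ)) (Get (Weight k) (scalar rI) (scalar rJ)))))))"

definition prog_box :: "nat poly \<Rightarrow> 'd::finite prog" where
  "prog_box q = set_scalar rBox (poly_exp q (Mul (Const 2) (Mul size_exp (scalar rRadius))))"

text \<open>If \<open>A\<close> bounds the gains, prices are at most \<open>2 * A + 1\<close>, so their sum stays below \<open>n * (2 * A + 2)\<close>.
  Each round of an unfinished auction increases that sum, hence this many rounds finish it.\<close>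

definition prog_rounds :: "'d::finite prog" where
  "prog_rounds = set_scalar rRounds (Mul size_exp (Add (Mul (Const 2)
     (Mul (Add size_exp (Const 1)) (Mul (Const (int CARD('d))) (Mul (scalar rBox) (scalar rRadius))))) (Const 2)))"

text \<open>The identity matching is a first candidate, so that the search has something to compare with.\<close>

definition prog_init :: "'d::finite prog" where
  "prog_init = For rI (Const 1) size_exp (set_cell rBest (scalar rI) (scalar rI))"

text \<open>The profit of object \<open>j\<close> for the current person. The factor \<open>n + 1\<close> turns approximate into exact
  optimality, see \<open>auction_optimal\<close>.\<close>

definition gain_exp :: "'d::finite aexp \<Rightarrow> 'd aexp" where
  "gain_exp j = Sub (Mul (Add size_exp (Const 1))
     (sum_exp (\<lambda>k. Mul (scalar (rCoef k)) (Get (Weight k) (scalar rI) j)))) (cell rPrice j)"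

definition prog_choose :: "'d::finite prog" where
  "prog_choose = Seq (set_scalar rBid (Const 1))
     (For rJ (Const 1) size_exp
        (Cond (Le (gain_exp (scalar rBid)) (gain_exp (scalar rJ))) (set_scalar rBid (scalar rJ)) Skip))"

definition prog_bid :: "'d::finite prog" where
  "prog_bid = Seq prog_choose
     (Seq (set_cell rAsg (cell rOwner (scalar rBid)) (Const 0))
     (Seq (set_cell rOwner (scalar rBid) (scalar rI))
     (Seq (set_cell rAsg (scalar rI) (scalar rBid))
          (set_cell rPrice (scalar rBid) (Add (cell rPrice (scalar rBid)) (Const 1))))))"

definition prog_reset :: "'d::finite prog" where
  "prog_reset = For rI (Const 1) size_exp
     (Seq (set_cell rPrice (scalar rI) (Const 0))
     (Seq (set_cell rOwner (scalar rI) (Const 0))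
          (set_cell rAsg (scalar rI) (Const 0))))"

definition prog_round :: "'d::finite prog" where
  "prog_round = For rI (Const 1) size_exp
     (Cond (Le (cell rAsg (scalar rI)) (Const 0)) prog_bid Skip)"

definition prog_auction :: "'d::finite prog" where
  "prog_auction = Seq prog_reset (For rT (Const 1) (scalar rRounds) prog_round)"

definition prog_value :: "nat \<Rightarrow> nat \<Rightarrow> 'd::finite \<Rightarrow> 'd prog" where
  "prog_value src dst k = Seq (set_cell dst (Const (idx k)) (Const 0))
     (For rI (Const 1) size_exp (set_cell dst (Const (idx k))
        (Add (cell dst (Const (idx k))) (Get (Weight k) (scalar rI) (cell src (scalar rI))))))"

definition prog_values :: "nat \<Rightarrow> nat \<Rightarrow> 'd list \<Rightarrow> 'd::finite prog" where
  "prog_values src dst ks = foldr (\<lambda>k. Seq (prog_value src dst k)) ks Skip"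

definition prog_copy :: "'d::finite prog" where
  "prog_copy = For rI (Const 1) size_exp (set_cell rBest (scalar rI) (cell rAsg (scalar rI)))"

definition prog_compare :: "'d::finite prog" where
  "prog_compare = Seq (prog_values rAsg rValAsg dims) (Seq (prog_values rBest rValBest dims)
     (Seq (Query (Work rAnswer) (Const 0) (Const 0)
             (\<lambda>k. cell rValBest (Const (idx k))) (\<lambda>k. cell rValAsg (Const (idx k))))
          (Cond (Le (Const 1) (scalar rAnswer)) prog_copy Skip)))"

text \<open>One loop per dimension, each over the range of a coefficient of the linear functional.\<close>

definition prog_search :: "'d list \<Rightarrow> 'd::finite prog" where
  "prog_search ks = foldr (\<lambda>k. For (rCoef k) (Sub (Const 0) (scalar rBox)) (scalar rBox)) ks
     (Seq prog_auction prog_compare)"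

definition prog_output :: "'d::finite prog" where
  "prog_output = For rI (Const 1) size_exp (Assign Out (scalar rI) (cell rBest (scalar rI)) (Const 1))"

definition matching_prog :: "nat poly \<Rightarrow> 'd::finite prog" where
  "matching_prog q = Seq prog_radius (Seq (prog_box q) (Seq prog_rounds (Seq prog_init
     (Seq (prog_search dims) prog_output))))"

lemma writes_prog:
  "writes prog_choose = {Work rJ, Work rBid}"
  "writes prog_bid = {Work rJ, Work rBid, Work rPrice, Work rOwner, Work rAsg}"
  "writes prog_round = {Work rI, Work rJ, Work rBid, Work rPrice, Work rOwner, Work rAsg}"
  "writes prog_auction = {Work rI, Work rJ, Work rT, Work rBid, Work rPrice, Work rOwner, Work rAsg}"
  "writes (prog_value src dst k) = {Work rI, Work dst}"
  "writes (prog_values src dst ks) \<subseteq> {Work rI, Work dst}"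
  "writes prog_copy = {Work rI, Work rBest}"
  "writes prog_compare \<subseteq> {Work rI, Work rBest, Work rValAsg, Work rValBest, Work rAnswer}"
  "writes prog_output = {Work rI, Out}"
proof -
  show choose: "writes prog_choose = {Work rJ, Work rBid}"
    by (auto simp: prog_choose_def)
  show bid: "writes prog_bid = {Work rJ, Work rBid, Work rPrice, Work rOwner, Work rAsg}"
    by (auto simp: prog_bid_def choose)
  show round: "writes prog_round = {Work rI, Work rJ, Work rBid, Work rPrice, Work rOwner, Work rAsg}"
    by (auto simp: prog_round_def bid)
  show "writes prog_auction = {Work rI, Work rJ, Work rT, Work rBid, Work rPrice, Work rOwner, Work rAsg}"
    by (auto simp: prog_auction_def prog_reset_def round)
  show val: "writes (prog_value src dst k) = {Work rI, Work dst}" for src dst k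
    by (auto simp: prog_value_def)
  show vals: "writes (prog_values src dst ks) \<subseteq> {Work rI, Work dst}" for src dst ks
    by (induction ks) (auto simp: prog_values_def val)
  show copy: "writes prog_copy = {Work rI, Work rBest}"
    by (auto simp: prog_copy_def)
  show "writes prog_compare \<subseteq> {Work rI, Work rBest, Work rValAsg, Work rValBest, Work rAnswer}"
    using vals[of rAsg rValAsg dims] vals[of rBest rValBest dims]
    by (auto simp: prog_compare_def copy)
  show "writes prog_output = {Work rI, Out}"
    by (auto simp: prog_output_def)
qed

lemma writes_search:
  "writes (prog_search ks) \<subseteq> {Work m | m. rI \<le> m \<and> m < 14} \<union> (\<lambda>k. Work (rCoef k)) ` set ks"
proof (induction ks)
  case Nil
  show ?case
    using writes_prog(8) by (auto simp: prog_search_def writes_prog(4))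
next
  case (Cons k ks)
  then show ?case by (auto simp: prog_search_def)
qed

section \<open>Correctness of the program\<close>

lemma sum_int_last: "l \<le> (i::int) \<Longrightarrow> sum f {l..i} = sum f {l..i - 1} + f i"
proof -
  assume "l \<le> i"
  then have "{l..i} = insert i {l..i - 1}" by auto
  then show ?thesis by (simp add: add.commute)
qed

definition radius :: "nat \<Rightarrow> ('d::finite \<Rightarrow> int \<Rightarrow> int \<Rightarrow> int) \<Rightarrow> nat" where
  "radius n wt = nat (\<Sum>i\<in>{1..int n}. \<Sum>j\<in>{1..int n}. \<Sum>k\<in>UNIV. wt k i j * wt k i j)"

text \<open>The quantities that the program computes, as functions of the number \<open>d\<close> of dimensions and of the
  bound \<open>R\<close> for the weights: coefficients of functionals range over \<open>{- box..box}\<close>.\<close>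

definition box :: "nat poly \<Rightarrow> nat \<Rightarrow> nat \<Rightarrow> nat" where
  "box q n R = poly q (2 * (n * R))"

definition gain_bound :: "nat poly \<Rightarrow> nat \<Rightarrow> nat \<Rightarrow> nat \<Rightarrow> nat" where
  "gain_bound q d n R = (n + 1) * (d * (box q n R * R))"

definition rounds :: "nat poly \<Rightarrow> nat \<Rightarrow> nat \<Rightarrow> nat \<Rightarrow> nat" where
  "rounds q d n R = n * (2 * gain_bound q d n R + 2)"

text \<open>Large enough for each register and each iteration count. The summands are due to
  the loops over vertices, the weights, the weights of matchings, the loops over coefficients, and the
  rounds of the auction, whose number also exceeds all gains and prices.\<close>

definition store_bound :: "nat poly \<Rightarrow> nat \<Rightarrow> nat \<Rightarrow> nat \<Rightarrow> nat" where
  "store_bound q d n R = 1 + n + R + n * R + 2 * box q n R + rounds q d n R"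

locale matching_instance =
  fixes n :: nat and wt :: "'d::finite \<Rightarrow> int \<Rightarrow> int \<Rightarrow> int" and q :: "nat poly"
    and f :: "real ^ 'd \<Rightarrow> real"
  assumes n_pos: "1 \<le> n"
begin

abbreviation "R \<equiv> radius n wt"
abbreviation "C \<equiv> box q n R"
abbreviation "A \<equiv> gain_bound q CARD('d) n R"
abbreviation "T \<equiv> rounds q CARD('d) n R"
abbreviation "V \<equiv> store_bound q CARD('d) n R"
abbreviation "N \<equiv> {1..int n}"
abbreviation "runs' \<equiv> runs (comparison_oracle f) V"

definition val :: "(int \<Rightarrow> int) \<Rightarrow> 'd \<Rightarrow> int" where
  "val \<sigma> k = (\<Sum>i\<in>N. wt k i (\<sigma> i))"

definition objective :: "(int \<Rightarrow> int) \<Rightarrow> real" where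
  "objective \<sigma> = f (\<chi> k. real_of_int (val \<sigma> k))"

definition gain :: "('d \<Rightarrow> int) \<Rightarrow> int \<Rightarrow> int \<Rightarrow> int" where
  "gain c i j = (\<Sum>k\<in>UNIV. c k * wt k i j)"

text \<open>The matching \<open>\<sigma>\<close> makes the functional \<open>c\<close> superfluous: it is at least as good as some matching that
  maximises \<open>c\<close>. This is monotone in the objective value of \<open>\<sigma>\<close>, so it persists when \<open>\<sigma>\<close> is improved.\<close>

definition handled :: "('d \<Rightarrow> int) \<Rightarrow> (int \<Rightarrow> int) \<Rightarrow> bool" where
  "handled c \<sigma> \<longleftrightarrow> (\<exists>\<rho>\<in>perms n.
     (\<forall>\<tau>\<in>perms n. (\<Sum>k\<in>UNIV. c k * val \<tau> k) \<le> (\<Sum>k\<in>UNIV. c k * val \<rho> k)) \<and>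
     objective \<rho> \<le> objective \<sigma>)"

lemma V_ge:
  "1 \<le> V" "int n + 1 \<le> int V" "int R \<le> int V" "int n * int R \<le> int V" "2 * int C + 1 \<le> int V"
  "int T + 1 \<le> int V" "2 * int A + 1 \<le> int V"
proof -
  have "1 * (2 * A + 2) \<le> T"
    unfolding rounds_def using n_pos by (intro mult_right_mono) auto
  then have "2 * A + 1 \<le> V" by (simp add: store_bound_def)
  then show "2 * int A + 1 \<le> int V" by linarith
qed (auto simp: store_bound_def)

lemma int_radius: "int R = (\<Sum>i\<in>N. \<Sum>j\<in>N. \<Sum>k\<in>UNIV. wt k i j * wt k i j)"
  unfolding radius_def by (simp add: sum_nonneg)

lemma wt_le_radius:
  assumes "i \<in> N" "j \<in> N"
  shows "\<bar>wt k i j\<bar> \<le> int R"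
proof -
  have "\<bar>wt k i j\<bar> \<le> \<bar>wt k i j\<bar> * \<bar>wt k i j\<bar>"
    using mult_right_mono[of 1 "\<bar>wt k i j\<bar>" "\<bar>wt k i j\<bar>"] by (cases "wt k i j = 0") auto
  also have "\<dots> = wt k i j * wt k i j" by simp
  also have "\<dots> \<le> (\<Sum>k\<in>UNIV. wt k i j * wt k i j)"
    by (intro member_le_sum) auto
  also have "\<dots> \<le> (\<Sum>j\<in>N. \<Sum>k\<in>UNIV. wt k i j * wt k i j)"
    using assms by (intro member_le_sum[of j N "\<lambda>j. \<Sum>k\<in>UNIV. wt k i j * wt k i j"]) (auto intro: sum_nonneg)
  also have "\<dots> \<le> int R"
    unfolding int_radius using assms
    by (intro member_le_sum[of i N "\<lambda>i. \<Sum>j\<in>N. \<Sum>k\<in>UNIV. wt k i j * wt k i j"]) (auto intro!: sum_nonneg)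
  finally show ?thesis .
qed

lemma val_partial_bound:
  assumes "\<sigma> \<in> perms n" and "m \<le> int n"
  shows "\<bar>\<Sum>i\<in>{1..m}. wt k i (\<sigma> i)\<bar> \<le> int n * int R"
proof -
  have "\<bar>\<Sum>i\<in>{1..m}. wt k i (\<sigma> i)\<bar> \<le> (\<Sum>i\<in>{1..m}. int R)"
    using assms perms_range[OF assms(1)]
    by (intro order_trans[OF sum_abs] sum_mono wt_le_radius) auto
  also have "\<dots> \<le> (\<Sum>i\<in>N. int R)"
    using assms(2) by (intro sum_mono2) auto
  finally show ?thesis by simp
qed

lemma val_bound: "\<sigma> \<in> perms n \<Longrightarrow> \<bar>val \<sigma> k\<bar> \<le> int (n * R)"
  using val_partial_bound[of \<sigma> "int n" k] by (simp add: val_def)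

lemma gain_le:
  assumes "\<And>k. \<bar>c k\<bar> \<le> int C" and "i \<in> N" "j \<in> N"
  shows "\<bar>(int n + 1) * gain c i j\<bar> \<le> int A"
proof -
  have "\<bar>gain c i j\<bar> \<le> (\<Sum>k\<in>(UNIV :: 'd set). int C * int R)"
    unfolding gain_def using assms wt_le_radius
    by (intro order_trans[OF sum_abs] sum_mono) (auto simp: abs_mult intro!: mult_mono)
  then have "(int n + 1) * \<bar>gain c i j\<bar> \<le> (int n + 1) * (\<Sum>k\<in>(UNIV :: 'd set). int C * int R)"
    by (intro mult_left_mono) auto
  moreover have "\<bar>(int n + 1) * gain c i j\<bar> = (int n + 1) * \<bar>gain c i j\<bar>"
    by (simp add: abs_mult)
  ultimately show ?thesis by (simp add: gain_bound_def algebra_simps)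
qed

lemma sum_gain: "(\<Sum>i\<in>N. gain c i (\<sigma> i)) = (\<Sum>k\<in>UNIV. c k * val \<sigma> k)"
  unfolding gain_def val_def sum_distrib_left by (rule sum.swap)

lemma perms_cong: "(\<And>i. i \<in> N \<Longrightarrow> \<sigma> i = \<tau> i) \<Longrightarrow> \<sigma> \<in> perms n \<longleftrightarrow> \<tau> \<in> perms n"
  unfolding perms_def mem_Collect_eq by (rule bij_betw_cong)

lemma val_cong: "(\<And>i. i \<in> N \<Longrightarrow> \<sigma> i = \<tau> i) \<Longrightarrow> val \<sigma> = val \<tau>"
  unfolding val_def by (intro ext sum.cong) auto

lemma objective_cong: "(\<And>i. i \<in> N \<Longrightarrow> \<sigma> i = \<tau> i) \<Longrightarrow> objective \<sigma> = objective \<tau>"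
  using val_cong[of \<sigma> \<tau>] by (simp add: objective_def)

definition inputs :: "'d store \<Rightarrow> bool" where
  "inputs s \<longleftrightarrow> s Dim 0 0 = int n \<and> (\<forall>k. \<forall>i\<in>N. \<forall>j\<in>N. s (Weight k) i j = wt k i j)"

lemma inputs_agree_off: "agree_off X s s' \<Longrightarrow> X \<subseteq> insert Out (range Work) \<Longrightarrow> inputs s \<Longrightarrow> inputs s'"
  unfolding inputs_def agree_off_def
  by (metis arr.distinct(5,7,11) arr.distinct(3,9) imageE insertE subsetD)

lemma inputs_update [simp]: "inputs (update (Work m) i j v s) = inputs s"
  by (simp add: inputs_def)

lemma inputs_size: "inputs s \<Longrightarrow> s Dim 0 0 = int n"
  by (simp add: inputs_def)

lemma inputs_weight: "inputs s \<Longrightarrow> i \<in> N \<Longrightarrow> j \<in> N \<Longrightarrow> s (Weight k) i j = wt k i j"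
  by (simp add: inputs_def)

lemma runs_For_vertices:
  assumes "bounded_store V s" and "inputs s" and "I 1 s"
    and "writes P \<subseteq> insert Out (range Work)" and "Work m \<notin> writes P"
    and "\<And>i v s. I i s \<Longrightarrow> I i (update (Work m) 0 0 v s)"
    and "\<And>i s'. i \<in> N \<Longrightarrow> I i s' \<Longrightarrow> s' (Work m) 0 0 = i \<Longrightarrow> bounded_store V s' \<Longrightarrow> inputs s' \<Longrightarrow>
      agree_off (insert (Work m) (writes P)) s s' \<Longrightarrow> runs' P s' (I (i + 1))"
  shows "runs' (For m (Const 1) size_exp P) s (I (int n + 1))"
proof (rule runs_For[where l = 1])
  have inp: "inputs s'" if "agree_off (insert (Work m) (writes P)) s s'" for s'
    using inputs_agree_off[OF that] assms by auto
  show "aval size_exp s' = int n" if "agree_off (insert (Work m) (writes P)) s s'" for s'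
    using inp[OF that] by (simp add: inputs_def)
  show "runs' P s' (I (i + 1))" if "1 \<le> i" "i \<le> int n" "I i s'" "s' (Work m) 0 0 = i"
    "bounded_store V s'" "agree_off (insert (Work m) (writes P)) s s'" for i s'
    using assms(7)[of i s'] that inp by auto
qed (use assms V_ge in auto)

subsection \<open>The setup\<close>

lemma runs_radius:
  assumes "bounded_store V s" and "inputs s" and "s (Work rRadius) 0 0 = 0"
  shows "runs' prog_radius s (\<lambda>s'. s' (Work rRadius) 0 0 = int R)"
proof -
  define sq where "sq = (\<lambda>i j. \<Sum>k\<in>UNIV. wt k i j * wt k i j)"
  have sq: "0 \<le> sq i j" for i j
    by (simp add: sq_def sum_nonneg)
  have R: "int R = (\<Sum>i\<in>N. \<Sum>j\<in>N. sq i j)"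
    by (simp add: int_radius sq_def)
  define I where "I = (\<lambda>i (s :: 'd store). s (Work rRadius) 0 0 = (\<Sum>i'\<in>{1..i - 1}. \<Sum>j\<in>N. sq i' j))"
  have "runs' prog_radius s (I (int n + 1))"
    unfolding prog_radius_def
  proof (rule runs_For_vertices[OF assms(1,2)])
    show "I 1 s" using assms(3) by (simp add: I_def)
    fix i s1 assume i: "i \<in> N" "I i s1" "s1 (Work rI) 0 0 = i" and s1: "bounded_store V s1" "inputs s1"
    define J where "J = (\<lambda>j (s :: 'd store). s (Work rRadius) 0 0
      = (\<Sum>i'\<in>{1..i - 1}. \<Sum>j\<in>N. sq i' j) + (\<Sum>j'\<in>{1..j - 1}. sq i j'))"
    show "runs' (For rJ (Const 1) size_exp (set_scalar rRadius (Add (scalar rRadius)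
        (sum_exp (\<lambda>k. Mul (Get (Weight k) (scalar rI) (scalar rJ)) (Get (Weight k) (scalar rI) (scalar rJ)))))))
        s1 (I (i + 1))"
    proof (rule runs_conseq)
      show "runs' (For rJ (Const 1) size_exp (set_scalar rRadius (Add (scalar rRadius)
        (sum_exp (\<lambda>k. Mul (Get (Weight k) (scalar rI) (scalar rJ)) (Get (Weight k) (scalar rI) (scalar rJ)))))))
        s1 (J (int n + 1))"
      proof (rule runs_For_vertices[OF s1])
        show "J 1 s1" using i by (simp add: I_def J_def)
        fix j s2 assume j: "j \<in> N" "J j s2" "s2 (Work rJ) 0 0 = j" and s2: "bounded_store V s2" "inputs s2"
          and ag: "agree_off (insert (Work rJ) (writes (set_scalar rRadius (Add (scalar rRadius)
        (sum_exp (\<lambda>k. Mul (Get (Weight k) (scalar rI) (scalar rJ)) (Get (Weight k) (scalar rI) (scalar rJ)))))))) s1 s2"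
        have i2: "s2 (Work rI) 0 0 = i" using agree_offD[OF ag, of "Work rI"] i by simp
        have eq: "s2 (Work rRadius) 0 0 + (\<Sum>k\<in>UNIV. s2 (Weight k) i j * s2 (Weight k) i j)
          = (\<Sum>i'\<in>{1..i - 1}. \<Sum>j\<in>N. sq i' j) + (\<Sum>j'\<in>{1..j}. sq i j')"
          using j s2 i(1) sum_int_last[of 1 j "sq i"] by (simp add: J_def sq_def inputs_weight)
        have "(\<Sum>j'\<in>{1..j}. sq i j') \<le> (\<Sum>j'\<in>N. sq i j')"
          using j sq by (intro sum_mono2) auto
        then have "(\<Sum>i'\<in>{1..i - 1}. \<Sum>j\<in>N. sq i' j) + (\<Sum>j'\<in>{1..j}. sq i j')
          \<le> (\<Sum>i'\<in>{1..i}. \<Sum>j\<in>N. sq i' j)"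
          using i(1) sum_int_last[of 1 i "\<lambda>i'. \<Sum>j\<in>N. sq i' j"] by simp
        also have "\<dots> \<le> int R"
          unfolding R using i(1) sq by (intro sum_mono2 sum_nonneg) auto
        finally have "(\<Sum>i'\<in>{1..i - 1}. \<Sum>j\<in>N. sq i' j) + (\<Sum>j'\<in>{1..j}. sq i j') \<le> int V"
          using V_ge(3) by linarith
        moreover have "0 \<le> (\<Sum>i'\<in>{1..i - 1}. \<Sum>j\<in>N. sq i' j) + (\<Sum>j'\<in>{1..j}. sq i j')"
          using sq by (intro add_nonneg_nonneg sum_nonneg) auto
        ultimately show "runs' (set_scalar rRadius (Add (scalar rRadius)
        (sum_exp (\<lambda>k. Mul (Get (Weight k) (scalar rI) (scalar rJ)) (Get (Weight k) (scalar rI) (scalar rJ))))))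
          s2 (J (j + 1))"
          by (intro runs_Assign s2(1)) (use i2 j eq in \<open>auto simp: J_def\<close>)
      qed (auto simp: J_def)
      show "I (i + 1) s'" if "J (int n + 1) s'" for s'
        using that i(1) sum_int_last[of 1 i "\<lambda>i'. \<Sum>j\<in>N. sq i' j"] by (simp add: I_def J_def)
    qed
  qed (auto simp: I_def)
  then show ?thesis
    by (rule runs_conseq) (simp add: I_def R)
qed

lemma runs_box:
  assumes "bounded_store V s" and "inputs s" and "s (Work rRadius) 0 0 = int R"
  shows "runs' (prog_box q) s (\<lambda>s'. s' (Work rBox) 0 0 = int C)"
proof -
  have "aval (Mul (Const 2) (Mul size_exp (scalar rRadius))) s = int (2 * (n * R))"
    using assms by (simp add: inputs_def)
  from aval_poly_exp[OF this, of q] show ?thesis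
    unfolding prog_box_def using V_ge(5)
    by (intro runs_Assign assms(1)) (simp_all add: box_def)
qed

lemma runs_rounds:
  assumes "bounded_store V s" and "inputs s" and "s (Work rRadius) 0 0 = int R" and "s (Work rBox) 0 0 = int C"
  shows "runs' prog_rounds s (\<lambda>s'. s' (Work rRounds) 0 0 = int T)"
proof -
  have eq: "int n * (2 * ((int n + 1) * (int CARD('d) * (int C * int R))) + 2) = int T"
    by (simp add: rounds_def gain_bound_def algebra_simps)
  show ?thesis
    unfolding prog_rounds_def using V_ge(6) assms(3,4)
    by (intro runs_Assign assms(1)) (simp_all add: inputs_size assms(2) eq)
qed

lemma runs_init:
  assumes "bounded_store V s" and "inputs s"
  shows "runs' prog_init s (\<lambda>s'. s' (Work rBest) 0 \<in> perms n)"
proof -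
  define I where "I = (\<lambda>i (s :: 'd store). \<forall>i'\<in>{1..i - 1}. s (Work rBest) 0 i' = i')"
  have "runs' prog_init s (I (int n + 1))"
    unfolding prog_init_def
  proof (rule runs_For_vertices[OF assms])
    fix i s' assume "i \<in> N" "I i s'" "s' (Work rI) 0 0 = i" "bounded_store V s'"
    then show "runs' (set_cell rBest (scalar rI) (scalar rI)) s' (I (i + 1))"
      using V_ge(2) by (intro runs_Assign) (auto simp: I_def)
  qed (auto simp: I_def)
  then show ?thesis
  proof (rule runs_conseq)
    fix s' :: "'d store" assume "I (int n + 1) s'"
    then have "s' (Work rBest) 0 \<in> perms n \<longleftrightarrow> id \<in> perms n"
      by (intro perms_cong) (simp add: I_def)
    then show "s' (Work rBest) 0 \<in> perms n" by (simp add: perms_def)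
  qed
qed

subsection \<open>The auction\<close>

definition ready :: "'d store \<Rightarrow> bool" where
  "ready s \<longleftrightarrow> inputs s \<and> s (Work rBox) 0 0 = int C \<and> s (Work rRounds) 0 0 = int T"

definition coefs :: "('d \<Rightarrow> int) \<Rightarrow> 'd store \<Rightarrow> bool" where
  "coefs c s \<longleftrightarrow> (\<forall>k. s (Work (rCoef k)) 0 0 = c k \<and> \<bar>c k\<bar> \<le> int C)"

definition auction_state :: "('d \<Rightarrow> int) \<Rightarrow> 'd store \<Rightarrow> bool" where
  "auction_state c s \<longleftrightarrow> auction_inv (int n) (int A) (\<lambda>i j. (int n + 1) * gain c i j)
     (s (Work rPrice) 0) (s (Work rOwner) 0) (s (Work rAsg) 0)"

lemma ready_agree_off:
  assumes "agree_off X s s'" and "X \<subseteq> {Work m | m. 3 \<le> m}" and "ready s"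
  shows "ready s'"
proof -
  have "inputs s'"
    using inputs_agree_off[OF assms(1)] assms(2,3) by (auto simp: ready_def)
  moreover have "Work rBox \<notin> X" "Work rRounds \<notin> X" using assms(2) by auto
  ultimately show ?thesis
    using assms(3) agree_offD[OF assms(1)] by (simp add: ready_def)
qed

lemma coefs_agree_off:
  assumes "agree_off X s s'" and "X \<subseteq> {Work m | m. m < 14}" and "coefs c s"
  shows "coefs c s'"
proof -
  have "s' (Work (rCoef k)) = s (Work (rCoef k))" for k :: 'd
    using assms(2) rCoef_ge[of k] by (intro agree_offD[OF assms(1)]) auto
  then show ?thesis
    using assms(3) by (simp add: coefs_def)
qed

lemma aval_gain_exp:
  assumes "inputs s" and "coefs c s" and "s (Work rI) 0 0 = i" "i \<in> N" and "aval e s = j" "j \<in> N"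
  shows "aval (gain_exp e) s = (int n + 1) * gain c i j - s (Work rPrice) 0 j"
  using assms by (simp add: gain_exp_def inputs_size inputs_weight coefs_def gain_def)

lemma runs_choose:
  assumes "bounded_store V s" and "inputs s" and "coefs c s" and "s (Work rI) 0 0 = i" "i \<in> N"
  shows "runs' prog_choose s (\<lambda>s'. s' (Work rBid) 0 0 \<in> N \<and>
    (\<forall>j\<in>N. (int n + 1) * gain c i j - s (Work rPrice) 0 j \<le>
       (int n + 1) * gain c i (s' (Work rBid) 0 0) - s (Work rPrice) 0 (s' (Work rBid) 0 0)))"
proof -
  define h where "h = (\<lambda>j. (int n + 1) * gain c i j - s (Work rPrice) 0 j)"
  define J where "J = (\<lambda>j (s' :: 'd store). s' (Work rBid) 0 0 \<in> N \<and>
    (\<forall>j'\<in>{1..j - 1}. h j' \<le> h (s' (Work rBid) 0 0)))"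
  have one: "1 \<in> N" using n_pos by simp
  have "runs' prog_choose s (J (int n + 1))"
    unfolding prog_choose_def
  proof (rule runs_Assign_Seq[OF assms(1)])
    let ?s = "update (Work rBid) (aval (Const 0) s) (aval (Const 0) s) (aval (Const 1) s) s"
    assume b: "bounded_store V ?s"
    have ag0: "agree_off {Work rJ, Work rBid} s ?s" by simp
    show "runs' (For rJ (Const 1) size_exp
        (Cond (Le (gain_exp (scalar rBid)) (gain_exp (scalar rJ))) (set_scalar rBid (scalar rJ)) Skip)) ?s
      (J (int n + 1))"
    proof (rule runs_For_vertices[OF b])
      show "inputs ?s" using assms(2) by simp
      show "J 1 ?s" using one by (simp add: J_def)
      fix j s' assume j: "j \<in> N" "J j s'" "s' (Work rJ) 0 0 = j" and s': "bounded_store V s'" "inputs s'"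
        and "agree_off (insert (Work rJ) (writes (Cond (Le (gain_exp (scalar rBid)) (gain_exp (scalar rJ)))
          (set_scalar rBid (scalar rJ)) Skip))) ?s s'"
      then have ag: "agree_off {Work rJ, Work rBid} s s'"
        using agree_off_trans[OF ag0] by simp
      have c: "coefs c s'" using coefs_agree_off[OF ag] assms(3) by auto
      have i: "s' (Work rI) 0 0 = i" and p: "s' (Work rPrice) = s (Work rPrice)"
        using agree_offD[OF ag] assms(4) by auto
      have g: "aval (gain_exp (scalar rBid)) s' = h (s' (Work rBid) 0 0)"
        "aval (gain_exp (scalar rJ)) s' = h j"
        using j by (simp_all add: aval_gain_exp[OF s'(2) c i assms(5)] h_def p J_def)
      show "runs' (Cond (Le (gain_exp (scalar rBid)) (gain_exp (scalar rJ))) (set_scalar rBid (scalar rJ)) Skip) s'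
        (J (j + 1))"
      proof (rule runs_Cond[OF s'(1)])
        assume "bval (Le (gain_exp (scalar rBid)) (gain_exp (scalar rJ))) s'"
        then have le: "h (s' (Work rBid) 0 0) \<le> h j" by (simp add: g)
        have "h j' \<le> h j" if "j' \<in> {1..j}" for j'
        proof (cases "j' = j")
          case False
          then have "h j' \<le> h (s' (Work rBid) 0 0)" using that j(2) by (auto simp: J_def)
          with le show ?thesis by simp
        qed simp
        then show "runs' (set_scalar rBid (scalar rJ)) s' (J (j + 1))"
          using j V_ge(2) by (intro runs_Assign s'(1)) (auto simp: J_def)
      next
        assume "\<not> bval (Le (gain_exp (scalar rBid)) (gain_exp (scalar rJ))) s'"
        then have le: "h j \<le> h (s' (Work rBid) 0 0)" by (simp add: g)
        have "h j' \<le> h (s' (Work rBid) 0 0)" if "j' \<in> {1..j}" for j'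
          using le that j(2) by (cases "j' = j") (auto simp: J_def)
        then show "runs' Skip s' (J (j + 1))"
          using j(2) by (intro runs_Skip s'(1)) (auto simp: J_def)
      qed
    qed (auto simp: J_def)
  qed (use V_ge in simp)
  then show ?thesis
    by (rule runs_conseq) (simp add: J_def h_def)
qed

lemma sum_increment: "finite B \<Longrightarrow> b \<in> B \<Longrightarrow> (\<Sum>j\<in>B. (p(b := p b + 1)) j) = (\<Sum>j\<in>B. p j) + (1::int)"
proof -
  assume B: "finite B" "b \<in> B"
  have "(\<Sum>j\<in>B. (p(b := p b + 1)) j) = (\<Sum>j\<in>B. p j + (if j = b then 1 else 0))"
    by (rule sum.cong) auto
  also have "\<dots> = (\<Sum>j\<in>B. p j) + 1" using B by (simp add: sum.distrib)
  finally show ?thesis .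
qed

lemma runs_bid:
  assumes "bounded_store V s" and "inputs s" and "coefs c s" and "s (Work rI) 0 0 = i" "i \<in> N"
    and "auction_state c s" and "s (Work rAsg) 0 i = 0"
  shows "runs' prog_bid s (\<lambda>s'. auction_state c s' \<and>
    (\<Sum>j\<in>N. s' (Work rPrice) 0 j) = (\<Sum>j\<in>N. s (Work rPrice) 0 j) + 1)"
  unfolding prog_bid_def
proof (rule runs_Seq[OF runs_choose[OF assms(1-5)]])
  fix s1 assume max: "s1 (Work rBid) 0 0 \<in> N \<and>
    (\<forall>j\<in>N. (int n + 1) * gain c i j - s (Work rPrice) 0 j \<le>
       (int n + 1) * gain c i (s1 (Work rBid) 0 0) - s (Work rPrice) 0 (s1 (Work rBid) 0 0))"
    and s1: "bounded_store V s1" and ag: "agree_off (writes prog_choose) s s1"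
  define b where "b = s1 (Work rBid) 0 0"
  have eqs: "s1 (Work rPrice) = s (Work rPrice)" "s1 (Work rOwner) = s (Work rOwner)"
    "s1 (Work rAsg) = s (Work rAsg)" "s1 (Work rI) = s (Work rI)"
    using agree_offD[OF ag] by (auto simp: writes_prog)
  have c: "\<And>k. \<bar>c k\<bar> \<le> int C" using assms(3) by (simp add: coefs_def)
  have b: "b \<in> N" using max by (simp add: b_def)
  have inv: "auction_inv (int n) (int A) (\<lambda>i j. (int n + 1) * gain c i j)
    ((s (Work rPrice) 0)(b := s (Work rPrice) 0 b + 1)) ((s (Work rOwner) 0)(b := i))
    ((s (Work rAsg) 0)(s (Work rOwner) 0 b := 0, i := b))"
    by (rule auction_bid) (use assms max gain_le[OF c] in \<open>auto simp: auction_state_def b_def\<close>)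
  then have p: "0 \<le> s (Work rPrice) 0 b + 1" "s (Work rPrice) 0 b + 1 \<le> int V"
    using b V_ge(7) unfolding auction_inv_def by (fastforce dest!: bspec[of _ _ b])+
  have bound: "\<bar>i\<bar> \<le> int V" "\<bar>b\<bar> \<le> int V"
    using assms(5) b V_ge(2) by auto
  show "runs' (Seq (set_cell rAsg (cell rOwner (scalar rBid)) (Const 0))
     (Seq (set_cell rOwner (scalar rBid) (scalar rI))
     (Seq (set_cell rAsg (scalar rI) (scalar rBid))
          (set_cell rPrice (scalar rBid) (Add (cell rPrice (scalar rBid)) (Const 1)))))) s1
    (\<lambda>s'. auction_state c s' \<and> (\<Sum>j\<in>N. s' (Work rPrice) 0 j) = (\<Sum>j\<in>N. s (Work rPrice) 0 j) + 1)"
    using bound p inv b assms(4) sum_increment[of N b "s (Work rPrice) 0"]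
    by (intro runs_Assign_Seq runs_Assign s1; assumption?)
      (simp_all add: eqs b_def[symmetric] auction_state_def)
qed

definition assigned :: "'d store \<Rightarrow> bool" where
  "assigned s \<longleftrightarrow> (\<forall>i\<in>N. s (Work rAsg) 0 i \<noteq> 0)"

text \<open>After \<open>r\<close> rounds the auction is over, or prices have risen by at least \<open>r\<close> in total.\<close>

definition progress :: "('d \<Rightarrow> int) \<Rightarrow> int \<Rightarrow> 'd store \<Rightarrow> bool" where
  "progress c r s \<longleftrightarrow> auction_state c s \<and> (assigned s \<or> r \<le> (\<Sum>j\<in>N. s (Work rPrice) 0 j))"

lemma auction_state_update:
  "m \<noteq> rPrice \<Longrightarrow> m \<noteq> rOwner \<Longrightarrow> m \<noteq> rAsg \<Longrightarrow> auction_state c (update (Work m) i j v s) = auction_state c s"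
  by (simp add: auction_state_def)

lemma runs_round:
  assumes "bounded_store V s" and "inputs s" and "coefs c s" and "progress c r s"
  shows "runs' prog_round s (progress c (r + 1))"
proof -
  \<comment> \<open>Either somebody has bid in this round, or all persons visited so far are assigned.\<close>
  define J where "J = (\<lambda>i s. auction_state c s \<and> (assigned s \<or> r + 1 \<le> (\<Sum>j\<in>N. s (Work rPrice) 0 j) \<or>
    r \<le> (\<Sum>j\<in>N. s (Work rPrice) 0 j) \<and> (\<forall>i'\<in>{1..i - 1}. s (Work rAsg) 0 i' \<noteq> 0)))"
  have "runs' prog_round s (J (int n + 1))"
    unfolding prog_round_def
  proof (rule runs_For_vertices[OF assms(1,2)])
    show "J 1 s" using assms(4) by (auto simp: J_def progress_def)
    fix i s' assume i: "i \<in> N" "J i s'" "s' (Work rI) 0 0 = i" and s': "bounded_store V s'" "inputs s'"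
      and "agree_off (insert (Work rI) (writes (Cond (Le (cell rAsg (scalar rI)) (Const 0)) prog_bid Skip))) s s'"
    then have c: "coefs c s'"
      using coefs_agree_off[OF _ _ assms(3)] by (force simp: writes_prog)
    show "runs' (Cond (Le (cell rAsg (scalar rI)) (Const 0)) prog_bid Skip) s' (J (i + 1))"
    proof (rule runs_Cond[OF s'(1)])
      assume "bval (Le (cell rAsg (scalar rI)) (Const 0)) s'"
      then have free: "s' (Work rAsg) 0 i = 0"
        using i by (auto simp: J_def auction_state_def auction_inv_def)
      show "runs' prog_bid s' (J (i + 1))"
      proof (rule runs_conseq[OF runs_bid[OF s' c i(3,1) _ free]])
        show "auction_state c s'" using i by (simp add: J_def)
        fix s'' assume "auction_state c s'' \<and>
          (\<Sum>j\<in>N. s'' (Work rPrice) 0 j) = (\<Sum>j\<in>N. s' (Work rPrice) 0 j) + 1"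
        then show "J (i + 1) s''"
          using i free by (auto simp: J_def assigned_def)
      qed
    next
      assume "\<not> bval (Le (cell rAsg (scalar rI)) (Const 0)) s'"
      then have "s' (Work rAsg) 0 i \<noteq> 0" using i by auto
      then have "(\<forall>i'\<in>{1..i - 1}. s' (Work rAsg) 0 i' \<noteq> 0) \<Longrightarrow> \<forall>i'\<in>{1..i}. s' (Work rAsg) 0 i' \<noteq> 0"
        by (metis atLeastAtMost_iff order_le_less zle_diff1_eq)
      then show "runs' Skip s' (J (i + 1))"
        using i by (intro runs_Skip s'(1)) (auto simp: J_def)
    qed
  qed (auto simp: J_def writes_prog auction_state_update assigned_def)
  then show ?thesis
    by (rule runs_conseq) (auto simp: J_def progress_def assigned_def)
qed

lemma runs_reset:
  assumes "bounded_store V s" and "inputs s"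
  shows "runs' prog_reset s (auction_state c)"
proof -
  define I where "I = (\<lambda>i (s :: 'd store). \<forall>i'\<in>{1..i - 1}.
    s (Work rPrice) 0 i' = 0 \<and> s (Work rOwner) 0 i' = 0 \<and> s (Work rAsg) 0 i' = 0)"
  have "runs' prog_reset s (I (int n + 1))"
    unfolding prog_reset_def
  proof (rule runs_For_vertices[OF assms])
    fix i s' assume "i \<in> N" "I i s'" "s' (Work rI) 0 0 = i" "bounded_store V s'"
    then show "runs' (Seq (set_cell rPrice (scalar rI) (Const 0)) (Seq (set_cell rOwner (scalar rI) (Const 0))
      (set_cell rAsg (scalar rI) (Const 0)))) s' (I (i + 1))"
      by (intro runs_Assign_Seq runs_Assign; assumption?) (auto simp: I_def)
  qed (auto simp: I_def)
  then show ?thesis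
    by (rule runs_conseq) (simp add: I_def auction_state_def auction_inv_def)
qed

text \<open>Prices cannot have risen by as much as the number of rounds, so everybody is assigned in the end.\<close>

lemma runs_auction:
  assumes "bounded_store V s" and "ready s" and "coefs c s"
  shows "runs' prog_auction s (\<lambda>s'. s' (Work rAsg) 0 \<in> perms n \<and>
    (\<forall>\<tau>\<in>perms n. (\<Sum>k\<in>UNIV. c k * val \<tau> k) \<le> (\<Sum>k\<in>UNIV. c k * val (s' (Work rAsg) 0) k)))"
  unfolding prog_auction_def
proof (rule runs_Seq)
  show "runs' prog_reset s (auction_state c)"
    using assms by (intro runs_reset) (auto simp: ready_def)
  fix s1 assume st: "auction_state c s1" and s1: "bounded_store V s1"
    and ag: "agree_off (writes prog_reset) s s1"
  have r1: "ready s1" and c1: "coefs c s1"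
    using ready_agree_off[OF ag _ assms(2)] coefs_agree_off[OF ag _ assms(3)]
    by (auto simp: prog_reset_def)
  have "runs' (For rT (Const 1) (scalar rRounds) prog_round) s1 (\<lambda>s'. progress c (int T + 1 - 1) s')"
  proof (rule runs_For[where l = 1 and I = "\<lambda>r. progress c (r - 1)"])
    have "0 \<le> (\<Sum>j\<in>N. s1 (Work rPrice) 0 j)"
      using st by (intro sum_nonneg) (simp add: auction_state_def auction_inv_def)
    then show "progress c (1 - 1) s1" using st by (simp add: progress_def)
    have ready: "ready s'" and coefs: "coefs c s'"
      if "agree_off (insert (Work rT) (writes prog_round)) s1 s'" for s'
      using ready_agree_off[OF that _ r1] coefs_agree_off[OF that _ c1] by (auto simp: writes_prog)
    show "aval (scalar rRounds) s' = int T"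
      if "agree_off (insert (Work rT) (writes prog_round)) s1 s'" for s'
      using ready[OF that] by (simp add: ready_def)
    show "runs' prog_round s' (progress c (r + 1 - 1))"
      if "progress c (r - 1) s'" "bounded_store V s'"
        "agree_off (insert (Work rT) (writes prog_round)) s1 s'" for r s'
      using runs_round[OF that(2) _ coefs[OF that(3)] that(1)] ready[OF that(3)] by (simp add: ready_def)
  qed (use s1 V_ge in \<open>auto simp: writes_prog progress_def auction_state_update assigned_def\<close>)
  then show "runs' (For rT (Const 1) (scalar rRounds) prog_round) s1 (\<lambda>s'. s' (Work rAsg) 0 \<in> perms n \<and>
    (\<forall>\<tau>\<in>perms n. (\<Sum>k\<in>UNIV. c k * val \<tau> k) \<le> (\<Sum>k\<in>UNIV. c k * val (s' (Work rAsg) 0) k)))"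
  proof (rule runs_conseq)
    fix s' :: "'d store" assume p: "progress c (int T + 1 - 1) s'"
    then have inv: "auction_inv (int n) (int A) (\<lambda>i j. (int n + 1) * gain c i j)
      (s' (Work rPrice) 0) (s' (Work rOwner) 0) (s' (Work rAsg) 0)"
      by (simp add: progress_def auction_state_def)
    have "(\<Sum>j\<in>N. s' (Work rPrice) 0 j) \<le> int n * (2 * int A + 1)"
      using auction_sum_price[OF inv] by simp
    also have "\<dots> < int T"
      using n_pos by (simp add: rounds_def algebra_simps)
    finally have "assigned s'" using p by (simp add: progress_def)
    then have a: "\<And>i. i \<in> N \<Longrightarrow> s' (Work rAsg) 0 i \<noteq> 0" by (simp add: assigned_def)
    note opt = auction_optimal[OF inv _ a]
    show "s' (Work rAsg) 0 \<in> perms n \<and>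
      (\<forall>\<tau>\<in>perms n. (\<Sum>k\<in>UNIV. c k * val \<tau> k) \<le> (\<Sum>k\<in>UNIV. c k * val (s' (Work rAsg) 0) k))"
      using opt unfolding perms_def sum_gain[symmetric] by auto
  qed
qed

subsection \<open>Comparing two matchings\<close>

lemma runs_value:
  assumes "bounded_store V s" and "inputs s" and "s (Work src) 0 = \<sigma>" and "\<sigma> \<in> perms n"
    and "dst \<noteq> src" "rI \<noteq> src" "rI \<noteq> dst"
  shows "runs' (prog_value src dst k) s (\<lambda>s'. s' (Work dst) 0 = (s (Work dst) 0)(idx k := val \<sigma> k))"
proof -
  define J where "J = (\<lambda>i (s' :: 'd store).
    s' (Work dst) 0 = (s (Work dst) 0)(idx k := (\<Sum>i'\<in>{1..i - 1}. wt k i' (\<sigma> i'))))"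
  have "runs' (prog_value src dst k) s (J (int n + 1))"
    unfolding prog_value_def
  proof (rule runs_Assign_Seq[OF assms(1)])
    let ?s = "update (Work dst) (aval (Const 0) s) (aval (Const (idx k)) s) (aval (Const 0) s) s"
    assume b: "bounded_store V ?s"
    show "runs' (For rI (Const 1) size_exp (set_cell dst (Const (idx k))
        (Add (cell dst (Const (idx k))) (Get (Weight k) (scalar rI) (cell src (scalar rI)))))) ?s (J (int n + 1))"
    proof (rule runs_For_vertices[OF b])
      show "J 1 ?s" by (simp add: J_def)
      fix i s' assume i: "i \<in> N" "J i s'" "s' (Work rI) 0 0 = i" and s': "bounded_store V s'" "inputs s'"
        and ag: "agree_off (insert (Work rI) (writes (set_cell dst (Const (idx k))
        (Add (cell dst (Const (idx k))) (Get (Weight k) (scalar rI) (cell src (scalar rI))))))) ?s s'"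
      have "s' (Work src) 0 i = \<sigma> i"
        using agree_offD[OF ag, of "Work src"] assms by simp
      moreover have "s' (Weight k) i (\<sigma> i) = wt k i (\<sigma> i)"
        using inputs_weight[OF s'(2) i(1)] perms_range[OF assms(4) i(1)] by simp
      moreover have "(\<Sum>i'\<in>{1..i - 1}. wt k i' (\<sigma> i')) + wt k i (\<sigma> i) = (\<Sum>i'\<in>{1..i}. wt k i' (\<sigma> i'))"
        using i(1) sum_int_last[of 1 i "\<lambda>i'. wt k i' (\<sigma> i')"] by simp
      moreover have "\<bar>\<Sum>i'\<in>{1..i}. wt k i' (\<sigma> i')\<bar> \<le> int V"
        using val_partial_bound[OF assms(4), of i k] i(1) V_ge(4) by simp
      ultimately show "runs' (set_cell dst (Const (idx k))
        (Add (cell dst (Const (idx k))) (Get (Weight k) (scalar rI) (cell src (scalar rI))))) s' (J (i + 1))"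
        using i by (intro runs_Assign s'(1)) (simp_all add: J_def)
    qed (use assms in \<open>auto simp: J_def\<close>)
  qed (use V_ge in simp)
  then show ?thesis
    by (rule runs_conseq) (simp add: J_def val_def)
qed

lemma runs_values:
  assumes "bounded_store V s" and "inputs s" and "s (Work src) 0 = \<sigma>" and "\<sigma> \<in> perms n"
    and "dst \<noteq> src" "rI \<noteq> src" "rI \<noteq> dst"
  shows "runs' (prog_values src dst ks) s (\<lambda>s'. \<forall>k\<in>set ks. s' (Work dst) 0 (idx k) = val \<sigma> k)"
proof -
  have "runs' (prog_values src dst ks) s (\<lambda>s'. \<forall>k\<in>K \<union> set ks. s' (Work dst) 0 (idx k) = val \<sigma> k)"
    if "\<forall>k\<in>K. s (Work dst) 0 (idx k) = val \<sigma> k" for K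
    using assms(1-3) that
  proof (induction ks arbitrary: s K)
    case Nil
    then show ?case by (simp add: prog_values_def runs_Skip)
  next
    case (Cons k ks)
    have "runs' (Seq (prog_value src dst k) (prog_values src dst ks)) s
      (\<lambda>s'. \<forall>k\<in>insert k K \<union> set ks. s' (Work dst) 0 (idx k) = val \<sigma> k)"
    proof (rule runs_Seq[OF runs_value[OF Cons.prems(1-3) assms(4-7)]])
      fix s1 assume s1: "s1 (Work dst) 0 = (s (Work dst) 0)(idx k := val \<sigma> k)" "bounded_store V s1"
        and ag: "agree_off (writes (prog_value src dst k)) s s1"
      have "inputs s1" using inputs_agree_off[OF ag _ Cons.prems(2)] by (auto simp: writes_prog)
      moreover have "s1 (Work src) 0 = \<sigma>"
        using agree_offD[OF ag, of "Work src"] Cons.prems(3) assms(5,6) by (simp add: writes_prog)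
      ultimately show "runs' (prog_values src dst ks) s1
        (\<lambda>s'. \<forall>k\<in>insert k K \<union> set ks. s' (Work dst) 0 (idx k) = val \<sigma> k)"
        using Cons.prems(4) by (intro Cons.IH s1(2)) (simp_all add: s1(1))
    qed
    then show ?case by (simp add: prog_values_def)
  qed
  from this[of "{}"] show ?thesis by simp
qed

lemma runs_copy:
  assumes "bounded_store V s" and "inputs s"
  shows "runs' prog_copy s (\<lambda>s'. \<forall>i\<in>N. s' (Work rBest) 0 i = s (Work rAsg) 0 i)"
proof -
  define I where "I = (\<lambda>i (s' :: 'd store). \<forall>i'\<in>{1..i - 1}. s' (Work rBest) 0 i' = s (Work rAsg) 0 i')"
  have "runs' prog_copy s (I (int n + 1))"
    unfolding prog_copy_def
  proof (rule runs_For_vertices[OF assms])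
    fix i s' assume i: "i \<in> N" "I i s'" "s' (Work rI) 0 0 = i" "bounded_store V s'"
      and ag: "agree_off (insert (Work rI) (writes (set_cell rBest (scalar rI) (cell rAsg (scalar rI))))) s s'"
    have "s' (Work rAsg) = s (Work rAsg)" using agree_offD[OF ag] by simp
    moreover have "\<bar>s (Work rAsg) 0 i\<bar> \<le> int V" using assms(1) by (simp add: bounded_store_def)
    ultimately show "runs' (set_cell rBest (scalar rI) (cell rAsg (scalar rI))) s' (I (i + 1))"
      using i by (intro runs_Assign i(4)) (auto simp: I_def)
  qed (auto simp: I_def)
  then show ?thesis
    by (rule runs_conseq) (simp add: I_def)
qed

lemma runs_compare:
  assumes "bounded_store V s" and "inputs s" and "s (Work rAsg) 0 = \<rho>" "\<rho> \<in> perms n"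
    and "s (Work rBest) 0 = \<sigma>" "\<sigma> \<in> perms n"
  shows "runs' prog_compare s (\<lambda>s'. s' (Work rBest) 0 \<in> perms n \<and>
    objective \<sigma> \<le> objective (s' (Work rBest) 0) \<and> objective \<rho> \<le> objective (s' (Work rBest) 0))"
    (is "runs' _ _ ?Q")
proof -
  have Vone: "1 \<le> V" by (rule V_ge)
  show ?thesis unfolding prog_compare_def
  proof (rule runs_Seq[OF runs_values[OF assms(1-4)]])
    fix s1 assume v1: "\<forall>k\<in>set dims. s1 (Work rValAsg) 0 (idx k) = val \<rho> k" and s1: "bounded_store V s1"
      and "agree_off (writes (prog_values rAsg rValAsg dims)) s s1"
    then have ag1: "agree_off {Work rI, Work rValAsg} s s1"
      using agree_off_mono writes_prog(6) by blast
    have inp1: "inputs s1" using inputs_agree_off[OF ag1 _ assms(2)] by auto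
    have best1: "s1 (Work rBest) 0 = \<sigma>" and asg1: "s1 (Work rAsg) 0 = \<rho>"
      using agree_offD[OF ag1] assms by auto
    show "runs' (Seq (prog_values rBest rValBest dims)
     (Seq (Query (Work rAnswer) (Const 0) (Const 0)
             (\<lambda>k. cell rValBest (Const (idx k))) (\<lambda>k. cell rValAsg (Const (idx k))))
          (Cond (Le (Const 1) (scalar rAnswer)) prog_copy Skip))) s1 ?Q"
    proof (rule runs_Seq[OF runs_values[OF s1 inp1 best1 assms(6)]])
      fix s2 assume v2: "\<forall>k\<in>set dims. s2 (Work rValBest) 0 (idx k) = val \<sigma> k" and s2: "bounded_store V s2"
        and "agree_off (writes (prog_values rBest rValBest dims)) s1 s2"
      then have ag2: "agree_off {Work rI, Work rValBest} s1 s2"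
        using agree_off_mono writes_prog(6) by blast
      have inp2: "inputs s2" using inputs_agree_off[OF ag2 _ inp1] by auto
      have best2: "s2 (Work rBest) 0 = \<sigma>" and asg2: "s2 (Work rAsg) 0 = \<rho>"
        and v1': "s2 (Work rValAsg) = s1 (Work rValAsg)"
        using agree_offD[OF ag2] best1 asg1 by auto
      let ?better = "objective \<sigma> \<le> objective \<rho>"
      have answer: "comparison_oracle f (\<chi> k. aval (cell rValBest (Const (idx k))) s2)
          (\<chi> k. aval (cell rValAsg (Const (idx k))) s2) = ?better"
        using v1 v2 by (simp add: comparison_oracle_def objective_def dims v1')
      show "runs' (Seq (Query (Work rAnswer) (Const 0) (Const 0)
             (\<lambda>k. cell rValBest (Const (idx k))) (\<lambda>k. cell rValAsg (Const (idx k))))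
          (Cond (Le (Const 1) (scalar rAnswer)) prog_copy Skip)) s2 ?Q"
      proof (rule runs_Seq)
        let ?s3 = "update (Work rAnswer) 0 0 (of_bool ?better) s2"
        show "runs' (Query (Work rAnswer) (Const 0) (Const 0)
             (\<lambda>k. cell rValBest (Const (idx k))) (\<lambda>k. cell rValAsg (Const (idx k)))) s2 (\<lambda>s'. s' = ?s3)"
          by (rule runs_Query[OF s2 Vone]) (simp only: answer aval.simps(1))
        fix s3 assume s3: "s3 = ?s3" "bounded_store V s3"
        have inp3: "inputs s3" and asg3: "s3 (Work rAsg) 0 = \<rho>" and best3: "s3 (Work rBest) 0 = \<sigma>"
          using inp2 asg2 best2 s3(1) by auto
        have ans: "s3 (Work rAnswer) 0 0 = (if ?better then 1 else 0)"
          unfolding s3(1) by simp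
        show "runs' (Cond (Le (Const 1) (scalar rAnswer)) prog_copy Skip) s3 ?Q"
        proof (rule runs_Cond[OF s3(2)])
          assume "bval (Le (Const 1) (scalar rAnswer)) s3"
          then have better: ?better using ans by (simp split: if_splits)
          show "runs' prog_copy s3 ?Q"
          proof (rule runs_conseq[OF runs_copy[OF s3(2) inp3]])
            fix s' :: "'d store" assume "\<forall>i\<in>N. s' (Work rBest) 0 i = s3 (Work rAsg) 0 i"
            then have eq: "s' (Work rBest) 0 i = \<rho> i" if "i \<in> N" for i
              using that asg3 by simp
            show "?Q s'"
              using perms_cong[OF eq] objective_cong[OF eq] assms(4) better by simp
          qed
        next
          assume "\<not> bval (Le (Const 1) (scalar rAnswer)) s3"
          then have "\<not> ?better" using ans by (simp split: if_splits)
          then show "runs' Skip s3 ?Q"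
            using assms(6) best3 by (intro runs_Skip s3(2)) simp
        qed
      qed
    qed simp_all
  qed simp_all
qed

subsection \<open>The search over all small functionals\<close>

lemma handled_mono: "handled c \<sigma> \<Longrightarrow> objective \<sigma> \<le> objective \<tau> \<Longrightarrow> handled c \<tau>"
  unfolding handled_def by (meson order_trans)

lemma runs_candidate:
  assumes "bounded_store V s" and "ready s" and "coefs c s" and "s (Work rBest) 0 \<in> perms n"
  shows "runs' (Seq prog_auction prog_compare) s (\<lambda>s'. s' (Work rBest) 0 \<in> perms n \<and>
    objective (s (Work rBest) 0) \<le> objective (s' (Work rBest) 0) \<and> handled c (s' (Work rBest) 0))"
proof (rule runs_Seq[OF runs_auction[OF assms(1-3)]])
  fix s1 assume opt: "s1 (Work rAsg) 0 \<in> perms n \<and>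
    (\<forall>\<tau>\<in>perms n. (\<Sum>k\<in>UNIV. c k * val \<tau> k) \<le> (\<Sum>k\<in>UNIV. c k * val (s1 (Work rAsg) 0) k))"
    and s1: "bounded_store V s1" and ag: "agree_off (writes prog_auction) s s1"
  have best: "s1 (Work rBest) 0 = s (Work rBest) 0"
    using agree_offD[OF ag] by (simp add: writes_prog)
  have inp: "inputs s1"
    using ready_agree_off[OF ag _ assms(2)] by (auto simp: writes_prog ready_def)
  show "runs' prog_compare s1 (\<lambda>s'. s' (Work rBest) 0 \<in> perms n \<and>
    objective (s (Work rBest) 0) \<le> objective (s' (Work rBest) 0) \<and> handled c (s' (Work rBest) 0))"
    by (rule runs_conseq[OF runs_compare[OF s1 inp refl _ best assms(4)]])
      (use opt in \<open>auto simp: handled_def\<close>)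
qed

text \<open>By induction on the nesting depth: \<open>c0\<close> contains the coefficients that the outer loops have fixed, and the
  search handles all functionals that extend it.\<close>

lemma runs_search:
  assumes "distinct ks" and "bounded_store V s" and "ready s" and "s (Work rBest) 0 \<in> perms n"
    and "\<forall>k. k \<notin> set ks \<longrightarrow> s (Work (rCoef k)) 0 0 = c0 k \<and> \<bar>c0 k\<bar> \<le> int C"
  shows "runs' (prog_search ks) s (\<lambda>s'. s' (Work rBest) 0 \<in> perms n \<and>
    objective (s (Work rBest) 0) \<le> objective (s' (Work rBest) 0) \<and>
    (\<forall>c. (\<forall>k. k \<notin> set ks \<longrightarrow> c k = c0 k) \<longrightarrow> (\<forall>k. \<bar>c k\<bar> \<le> int C) \<longrightarrow> handled c (s' (Work rBest) 0)))"
  using assms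
proof (induction ks arbitrary: s c0)
  case Nil
  then have "coefs c0 s" by (simp add: coefs_def)
  from runs_candidate[OF Nil(2,3) this Nil(4)] show ?case
    by (simp add: prog_search_def) (erule runs_conseq, metis ext)
next
  case (Cons k ks)
  let ?best = "\<lambda>s :: 'd store. s (Work rBest) 0"
  define I where "I = (\<lambda>i s'. ?best s' \<in> perms n \<and> objective (?best s) \<le> objective (?best s') \<and>
    (\<forall>c. (\<forall>l. l \<notin> set (k # ks) \<longrightarrow> c l = c0 l) \<longrightarrow> (\<forall>l. \<bar>c l\<bar> \<le> int C) \<longrightarrow> c k < i \<longrightarrow> handled c (?best s')))"
  have w: "writes (prog_search ks) \<subseteq> {Work m | m. rI \<le> m \<and> m < 14} \<union> (\<lambda>k. Work (rCoef k)) ` set ks"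
    by (rule writes_search)
  have "runs' (For (rCoef k) (Sub (Const 0) (scalar rBox)) (scalar rBox) (prog_search ks)) s (I (int C + 1))"
  proof (rule runs_For)
    show "bounded_store V s" by fact
    show "I (- int C) s"
      unfolding I_def using Cons.prems(4) by (auto simp: abs_le_iff) (metis abs_le_iff minus_le_iff not_le)
    show "aval (Sub (Const 0) (scalar rBox)) s = - int C"
      using Cons.prems(3) by (simp add: ready_def)
    show "Work (rCoef k) \<notin> writes (prog_search ks)"
      using w rCoef_ge[of k] Cons.prems(1) by auto
    show "I i (update (Work (rCoef k)) 0 0 v s')" if "I i s'" for i v s'
      using that rCoef_ge[of k] by (simp add: I_def)
    have ready: "ready s'" if "agree_off (insert (Work (rCoef k)) (writes (prog_search ks))) s s'" for s'
    proof (rule ready_agree_off[OF that _ Cons.prems(3)])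
      have "3 \<le> rCoef l" for l :: 'd using rCoef_ge[of l] by simp
      then show "insert (Work (rCoef k)) (writes (prog_search ks)) \<subseteq> {Work m |m. 3 \<le> m}"
        using w by auto
    qed
    show "aval (scalar rBox) s' = int C"
      if "agree_off (insert (Work (rCoef k)) (writes (prog_search ks))) s s'" for s'
      using ready[OF that] by (simp add: ready_def)
    fix i s' assume i: "- int C \<le> i" "i \<le> int C" "I i s'" "s' (Work (rCoef k)) 0 0 = i"
      and s': "bounded_store V s'" and ag: "agree_off (insert (Work (rCoef k)) (writes (prog_search ks))) s s'"
    let ?c = "c0(k := i)"
    have "s' (Work (rCoef l)) 0 0 = ?c l \<and> \<bar>?c l\<bar> \<le> int C" if "l \<notin> set ks" for l
    proof (cases "l = k")
      case False
      then have "Work (rCoef l) \<notin> insert (Work (rCoef k)) (writes (prog_search ks))"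
        using w that rCoef_ge[of l] by auto
      from agree_offD[OF ag this] show ?thesis using False that Cons.prems(5) by simp
    qed (use i in auto)
    then have "runs' (prog_search ks) s' (\<lambda>s''. ?best s'' \<in> perms n \<and>
        objective (?best s') \<le> objective (?best s'') \<and>
        (\<forall>c. (\<forall>l. l \<notin> set ks \<longrightarrow> c l = ?c l) \<longrightarrow> (\<forall>l. \<bar>c l\<bar> \<le> int C) \<longrightarrow> handled c (?best s'')))"
      using Cons.prems(1) i(3) by (intro Cons.IH s' ready[OF ag]) (auto simp: I_def)
    then show "runs' (prog_search ks) s' (I (i + 1))"
    proof (rule runs_conseq)
      fix s'' :: "'d store" assume s'': "?best s'' \<in> perms n \<and>
        objective (?best s') \<le> objective (?best s'') \<and>
        (\<forall>c. (\<forall>l. l \<notin> set ks \<longrightarrow> c l = ?c l) \<longrightarrow> (\<forall>l. \<bar>c l\<bar> \<le> int C) \<longrightarrow> handled c (?best s''))"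
      show "I (i + 1) s''"
        unfolding I_def
      proof (intro conjI allI impI)
        show "?best s'' \<in> perms n" using s'' by blast
        show "objective (?best s) \<le> objective (?best s'')"
          using s'' i(3) unfolding I_def by linarith
        fix c assume c: "\<forall>l. l \<notin> set (k # ks) \<longrightarrow> c l = c0 l" "\<forall>l. \<bar>c l\<bar> \<le> int C" "c k < i + 1"
        show "handled c (?best s'')"
        proof (cases "c k = i")
          case True
          then show ?thesis using s'' c by simp
        next
          case False
          then have "handled c (?best s')" using i(3) c unfolding I_def by simp
          then show ?thesis using s'' handled_mono by blast
        qed
      qed
    qed
  qed (use V_ge in auto)
  then show ?case
    unfolding prog_search_def foldr.simps comp_def
  proof (rule runs_conseq)
    fix s' :: "'d store" assume I: "I (int C + 1) s'"
    have "c k < int C + 1" if "\<forall>l. \<bar>c l\<bar> \<le> int C" for c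
      using that[rule_format, of k] by linarith
    with I show "?best s' \<in> perms n \<and> objective (?best s) \<le> objective (?best s') \<and>
      (\<forall>c. (\<forall>l. l \<notin> set (k # ks) \<longrightarrow> c l = c0 l) \<longrightarrow> (\<forall>l. \<bar>c l\<bar> \<le> int C) \<longrightarrow> handled c (?best s'))"
      unfolding I_def by blast
  qed
qed

text \<open>\<open>Out\<close> has not been touched before, so the only nonzero entries are those written here.\<close>

lemma runs_output:
  assumes "bounded_store V s" and "inputs s" and "\<And>i j. s Out i j = 0" and "s (Work rBest) 0 = \<sigma>" "\<sigma> \<in> perms n"
  shows "runs' prog_output s (\<lambda>s'. output_matching n s' = matching_of n \<sigma>)"
proof -
  define I where "I = (\<lambda>i (s' :: 'd store). \<forall>i' j. s' Out i' j \<noteq> 0 \<longleftrightarrow> i' \<in> {1..i - 1} \<and> j = \<sigma> i')"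
  have "runs' prog_output s (I (int n + 1))"
    unfolding prog_output_def
  proof (rule runs_For_vertices[OF assms(1,2)])
    show "I 1 s" using assms(3) by (simp add: I_def)
    fix i s' assume i: "i \<in> N" "I i s'" "s' (Work rI) 0 0 = i" "bounded_store V s'"
      and ag: "agree_off (insert (Work rI) (writes (Assign Out (scalar rI) (cell rBest (scalar rI)) (Const 1)))) s s'"
    have "s' (Work rBest) 0 = \<sigma>" using agree_offD[OF ag] assms(4) by simp
    then show "runs' (Assign Out (scalar rI) (cell rBest (scalar rI)) (Const 1)) s' (I (i + 1))"
      using i V_ge(1) by (intro runs_Assign i(4)) (auto simp: I_def)
  qed (auto simp: I_def)
  then show ?thesis
  proof (rule runs_conseq)
    fix s' :: "'d store" assume I: "I (int n + 1) s'"
    have "(i, j) \<in> output_matching n s' \<longleftrightarrow> (i, j) \<in> matching_of n \<sigma>" for i j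
      using I by (auto simp: output_matching_def matching_of_iff[OF assms(5)] I_def edges_def)
    then show "output_matching n s' = matching_of n \<sigma>" by auto
  qed
qed

lemma runs_matching_prog:
  assumes "bounded_store V s" and "inputs s" and "\<And>m i j. s (Work m) i j = 0" and "\<And>i j. s Out i j = 0"
  shows "runs' (matching_prog q) s (\<lambda>s'. \<exists>\<sigma>\<in>perms n. output_matching n s' = matching_of n \<sigma> \<and>
    (\<forall>c. (\<forall>k. \<bar>c k\<bar> \<le> int C) \<longrightarrow> handled c \<sigma>))" (is "runs' _ _ ?Q")
proof -
  have w1: "writes prog_radius = {Work rI, Work rJ, Work rRadius}" "writes (prog_box q) = {Work rBox}"
    "writes (prog_rounds :: 'd prog) = {Work rRounds}" "writes prog_init = {Work rI, Work rBest}"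
    by (auto simp: prog_radius_def prog_box_def prog_rounds_def prog_init_def)
  have step: "inputs s'' \<and> (\<forall>i j. s'' Out i j = 0)"
    if "agree_off X s' s''" "X \<subseteq> range Work" "inputs s' \<and> (\<forall>i j. s' Out i j = 0)" for X s' s''
  proof -
    have "Out \<notin> X" using that(2) by auto
    from agree_offD[OF that(1) this] show ?thesis
      using inputs_agree_off[OF that(1)] that(2,3) by auto
  qed
  have w_search: "writes (prog_search dims :: 'd prog) \<subseteq> range Work"
    using writes_search[of "dims :: 'd list"] by auto
  show ?thesis
    unfolding matching_prog_def
  proof (rule runs_Seq[OF runs_radius[OF assms(1,2,3)]])
    fix s1 assume s1: "s1 (Work rRadius) 0 0 = int R" "bounded_store V s1" "agree_off (writes prog_radius) s s1"
    have i1: "inputs s1 \<and> (\<forall>i j. s1 Out i j = 0)"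
      using step[OF s1(3)] assms(2,4) by (auto simp: w1)
    show "runs' (Seq (prog_box q) (Seq prog_rounds (Seq prog_init (Seq (prog_search dims) prog_output)))) s1 ?Q"
    proof (rule runs_Seq[OF runs_box[OF s1(2) _ s1(1)]])
      show "inputs s1" using i1 by blast
      fix s2 assume s2: "s2 (Work rBox) 0 0 = int C" "bounded_store V s2" "agree_off (writes (prog_box q)) s1 s2"
      have i2: "inputs s2 \<and> (\<forall>i j. s2 Out i j = 0)" using step[OF s2(3) _ i1] by (auto simp: w1)
      have r2: "s2 (Work rRadius) 0 0 = int R" using agree_offD[OF s2(3), of "Work rRadius"] s1(1) by (simp add: w1)
      show "runs' (Seq prog_rounds (Seq prog_init (Seq (prog_search dims) prog_output))) s2 ?Q"
      proof (rule runs_Seq[OF runs_rounds[OF s2(2) _ r2 s2(1)]])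
        show "inputs s2" using i2 by blast
        fix s3 assume s3: "s3 (Work rRounds) 0 0 = int T" "bounded_store V s3" "agree_off (writes (prog_rounds :: 'd prog)) s2 s3"
        have i3: "inputs s3 \<and> (\<forall>i j. s3 Out i j = 0)" using step[OF s3(3) _ i2] by (auto simp: w1)
        have b3: "s3 (Work rBox) 0 0 = int C" using agree_offD[OF s3(3), of "Work rBox"] s2(1) by (simp add: w1)
        have r3: "ready s3" unfolding ready_def using i3 b3 s3(1) by blast
        show "runs' (Seq prog_init (Seq (prog_search dims) prog_output)) s3 ?Q"
        proof (rule runs_Seq[OF runs_init[OF s3(2)]])
          show "inputs s3" using i3 by blast
          fix s4 assume s4: "s4 (Work rBest) 0 \<in> perms n" "bounded_store V s4" "agree_off (writes prog_init) s3 s4"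
          have i4: "inputs s4 \<and> (\<forall>i j. s4 Out i j = 0)" using step[OF s4(3) _ i3] by (auto simp: w1)
          have r4: "ready s4" using ready_agree_off[OF s4(3) _ r3] by (auto simp: w1)
          show "runs' (Seq (prog_search dims) prog_output) s4 ?Q"
          proof (rule runs_Seq[OF runs_search[OF dims(1) s4(2) r4 s4(1), of "\<lambda>_. 0"]])
            show "\<forall>k. k \<notin> set (dims :: 'd list) \<longrightarrow> s4 (Work (rCoef k)) 0 0 = 0 \<and> \<bar>0\<bar> \<le> int C"
              by (simp add: dims)
            fix s5 assume best: "s5 (Work rBest) 0 \<in> perms n \<and>
              objective (s4 (Work rBest) 0) \<le> objective (s5 (Work rBest) 0) \<and>
              (\<forall>c. (\<forall>k. k \<notin> set (dims :: 'd list) \<longrightarrow> c k = 0) \<longrightarrow> (\<forall>k. \<bar>c k\<bar> \<le> int C) \<longrightarrow> handled c (s5 (Work rBest) 0))"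
              and s5: "bounded_store V s5" "agree_off (writes (prog_search dims)) s4 s5"
            have i5: "inputs s5 \<and> (\<forall>i j. s5 Out i j = 0)"
              using step[OF s5(2) _ i4] w_search by blast
            have h: "\<forall>c. (\<forall>k. \<bar>c k\<bar> \<le> int C) \<longrightarrow> handled c (s5 (Work rBest) 0)"
              using best by (simp add: dims)
            show "runs' prog_output s5 ?Q"
              by (rule runs_conseq[OF runs_output[OF s5(1) _ _ refl]]) (use i5 best h in auto)
          qed
        qed
      qed
    qed
  qed
qed

end

section \<open>Polynomial bounds\<close>

text \<open>
  It is enough to bound the running time by an expression that is built from \<open>n\<close>, the largest weight,
  sums, products and polynomials.
\<close>

definition poly_bounded :: "(nat \<Rightarrow> nat \<Rightarrow> nat) \<Rightarrow> bool" where
  "poly_bounded g \<longleftrightarrow> (\<exists>p :: nat poly poly. \<forall>n m. g n m \<le> poly (poly p [:n:]) m)"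

lemma poly_bounded_const: "poly_bounded (\<lambda>_ _. c)"
  unfolding poly_bounded_def by (rule exI[of _ "[:[:c:]:]"]) simp

lemma poly_bounded_fst: "poly_bounded (\<lambda>n _. n)"
  unfolding poly_bounded_def by (rule exI[of _ "[:0, 1:]"]) simp

lemma poly_bounded_snd: "poly_bounded (\<lambda>_ m. m)"
  unfolding poly_bounded_def by (rule exI[of _ "[:[:0, 1:]:]"]) simp

lemma poly_bounded_add:
  assumes "poly_bounded g" "poly_bounded h"
  shows "poly_bounded (\<lambda>n m. g n m + h n m)"
proof -
  obtain p1 p2 where "\<And>n m. g n m \<le> poly (poly p1 [:n:]) m" "\<And>n m. h n m \<le> poly (poly p2 [:n:]) m"
    using assms unfolding poly_bounded_def by blast
  then show ?thesis
    unfolding poly_bounded_def by (intro exI[of _ "p1 + p2"]) (simp add: add_mono)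
qed

lemma poly_bounded_mult:
  assumes "poly_bounded g" "poly_bounded h"
  shows "poly_bounded (\<lambda>n m. g n m * h n m)"
proof -
  obtain p1 p2 where "\<And>n m. g n m \<le> poly (poly p1 [:n:]) m" "\<And>n m. h n m \<le> poly (poly p2 [:n:]) m"
    using assms unfolding poly_bounded_def by blast
  then show ?thesis
    unfolding poly_bounded_def by (intro exI[of _ "p1 * p2"]) (simp add: mult_mono)
qed

lemma poly_bounded_poly:
  assumes "poly_bounded g"
  shows "poly_bounded (\<lambda>n m. poly r (g n m))"
proof (induction r)
  case 0
  show ?case by (simp add: poly_bounded_const)
next
  case (pCons a r)
  then show ?case
    by (simp add: poly_bounded_add poly_bounded_mult poly_bounded_const assms)
qed

lemma poly_mono_nat: "x \<le> y \<Longrightarrow> poly (p :: nat poly) x \<le> poly p y"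
  by (induction p) (auto intro!: mult_mono)

lemma poly_bounded_store_bound:
  assumes "poly_bounded g"
  shows "poly_bounded (\<lambda>n m. store_bound q d n (g n m))"
  unfolding store_bound_def rounds_def gain_bound_def box_def
  by (intro poly_bounded_add poly_bounded_mult poly_bounded_poly poly_bounded_const poly_bounded_fst assms)

lemma store_bound_mono:
  assumes "R \<le> R'"
  shows "store_bound q d n R \<le> store_bound q d n R'"
  unfolding store_bound_def rounds_def gain_bound_def box_def
  by (intro add_mono mult_mono poly_mono_nat assms order_refl) auto

lemma abs_weight_le_max:
  fixes w :: "'d::finite \<Rightarrow> nat \<times> nat \<Rightarrow> int"
  assumes "e \<in> edges n"
  shows "\<bar>w k e\<bar> \<le> int (max_abs_weight n w)"
proof -
  have "{nat \<bar>w k e\<bar> | k e. e \<in> edges n} = (\<lambda>(k, e). nat \<bar>w k e\<bar>) ` (UNIV \<times> edges n)"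
    by auto
  moreover have "finite (edges n)" by (simp add: edges_def)
  ultimately have "finite {nat \<bar>w k e\<bar> | k e. e \<in> edges n}" by simp
  moreover have "nat \<bar>w k e\<bar> \<in> {nat \<bar>w k e\<bar> | k e. e \<in> edges n}"
    using assms by blast
  ultimately have "nat \<bar>w k e\<bar> \<le> max_abs_weight n w"
    unfolding max_abs_weight_def by (rule Max_ge)
  then show ?thesis by linarith
qed

lemma radius_le:
  fixes w :: "'d::finite \<Rightarrow> nat \<times> nat \<Rightarrow> int"
  shows "radius n (\<lambda>k i j. w k (nat i, nat j))
    \<le> n * (n * (CARD('d) * (max_abs_weight n w * max_abs_weight n w)))"
proof -
  let ?W = "int (max_abs_weight n w)"
  have sq: "w k (nat i, nat j) * w k (nat i, nat j) \<le> ?W * ?W" if "i \<in> {1..int n}" "j \<in> {1..int n}" for k i j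
  proof -
    have "(nat i, nat j) \<in> edges n" using that by (auto simp: edges_def)
    from abs_weight_le_max[OF this, of w k]
    have "\<bar>w k (nat i, nat j)\<bar> * \<bar>w k (nat i, nat j)\<bar> \<le> ?W * ?W" by (intro mult_mono) auto
    then show ?thesis by simp
  qed
  have "(\<Sum>i\<in>{1..int n}. \<Sum>j\<in>{1..int n}. \<Sum>k\<in>UNIV. w k (nat i, nat j) * w k (nat i, nat j))
    \<le> (\<Sum>i\<in>{1..int n}. \<Sum>j\<in>{1..int n}. \<Sum>k\<in>(UNIV :: 'd set). ?W * ?W)"
    by (intro sum_mono sq)
  then show ?thesis
    unfolding radius_def by (simp add: nat_le_iff)
qed

section \<open>Optimality of the result\<close>

context matching_instance
begin

text \<open>Among the functionals in the box is one whose only maximal weight vector is that of an optimal matching.\<close>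

lemma handled_all_optimal:
  assumes q: "\<And>R (S :: ('d \<Rightarrow> int) set) (f :: real ^ 'd \<Rightarrow> real).
       finite S \<Longrightarrow> S \<noteq> {} \<Longrightarrow> convex_on UNIV f \<Longrightarrow> (\<And>u k. u \<in> S \<Longrightarrow> \<bar>u k\<bar> \<le> int R) \<Longrightarrow>
       \<exists>v\<in>S. \<exists>c. (\<forall>u\<in>S. f (\<chi> k. real_of_int (u k)) \<le> f (\<chi> k. real_of_int (v k))) \<and>
         (\<forall>k. \<bar>c k\<bar> \<le> int (poly q (2 * R))) \<and>
         (\<forall>u\<in>S. u \<noteq> v \<longrightarrow> (\<Sum>k\<in>UNIV. c k * u k) < (\<Sum>k\<in>UNIV. c k * v k))"
    and f: "convex_on UNIV f" and handled: "\<And>c. \<forall>k. \<bar>c k\<bar> \<le> int C \<Longrightarrow> handled c \<sigma>"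
    and \<tau>: "\<tau> \<in> perms n"
  shows "objective \<tau> \<le> objective \<sigma>"
proof -
  have "val ` perms n \<subseteq> PiE UNIV (\<lambda>_. {- int (n * R)..int (n * R)})"
    using val_bound by (auto simp: PiE_def abs_le_iff) (metis minus_le_iff)
  then have fin: "finite (val ` perms n)"
    by (rule finite_subset) (intro finite_PiE finite_class.finite_UNIV finite_atLeastAtMost_int)
  have "\<exists>v\<in>val ` perms n. \<exists>c. (\<forall>u\<in>val ` perms n. f (\<chi> k. real_of_int (u k)) \<le> f (\<chi> k. real_of_int (v k))) \<and>
     (\<forall>k. \<bar>c k\<bar> \<le> int (poly q (2 * (n * R)))) \<and>
     (\<forall>u\<in>val ` perms n. u \<noteq> v \<longrightarrow> (\<Sum>k\<in>UNIV. c k * u k) < (\<Sum>k\<in>UNIV. c k * v k))"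
    by (rule q[OF fin _ f]) (use \<tau> val_bound in auto)
  then obtain v c where v: "v \<in> val ` perms n"
    "\<And>\<rho>. \<rho> \<in> perms n \<Longrightarrow> objective \<rho> \<le> f (\<chi> k. real_of_int (v k))"
    and c: "\<forall>k. \<bar>c k\<bar> \<le> int C"
    and uniq: "\<And>\<rho>. \<rho> \<in> perms n \<Longrightarrow> val \<rho> \<noteq> v \<Longrightarrow> (\<Sum>k\<in>UNIV. c k * val \<rho> k) < (\<Sum>k\<in>UNIV. c k * v k)"
    unfolding objective_def box_def by blast
  obtain \<rho> where \<rho>: "\<rho> \<in> perms n" "objective \<rho> \<le> objective \<sigma>"
    "\<And>\<tau>. \<tau> \<in> perms n \<Longrightarrow> (\<Sum>k\<in>UNIV. c k * val \<tau> k) \<le> (\<Sum>k\<in>UNIV. c k * val \<rho> k)"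
    using handled[OF c] unfolding handled_def by blast
  have "val \<rho> = v"
  proof (rule ccontr)
    assume "val \<rho> \<noteq> v"
    from uniq[OF \<rho>(1) this] \<rho>(3) v(1) show False by force
  qed
  then show ?thesis
    using v(2)[OF \<tau>] \<rho>(2) by (simp add: objective_def)
qed

end

theorem theorem1p1:
  shows "\<exists>(P :: 'd::finite prog) (p :: nat poly poly).
    \<forall>(n::nat) (w :: 'd \<Rightarrow> nat \<times> nat \<Rightarrow> int) (f :: real ^ 'd \<Rightarrow> real).
      n \<ge> 1 \<longrightarrow> convex_on UNIV f \<longrightarrow>
      (\<exists>t q s. exec (comparison_oracle f) P (input_store n w) t q s \<and>
        optimal_matching n w f (output_matching n s) \<and>
        t + q \<le> poly (poly p [:n:]) (max_abs_weight n w))"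
proof -
  obtain q :: "nat poly" where q: "\<And>R (S :: ('d \<Rightarrow> int) set) (f :: real ^ 'd \<Rightarrow> real).
       finite S \<Longrightarrow> S \<noteq> {} \<Longrightarrow> convex_on UNIV f \<Longrightarrow> (\<And>u k. u \<in> S \<Longrightarrow> \<bar>u k\<bar> \<le> int R) \<Longrightarrow>
       \<exists>v\<in>S. \<exists>c. (\<forall>u\<in>S. f (\<chi> k. real_of_int (u k)) \<le> f (\<chi> k. real_of_int (v k))) \<and>
         (\<forall>k. \<bar>c k\<bar> \<le> int (poly q (2 * R))) \<and>
         (\<forall>u\<in>S. u \<noteq> v \<longrightarrow> (\<Sum>k\<in>UNIV. c k * u k) < (\<Sum>k\<in>UNIV. c k * v k))"
    by (rule convex_max_small_functional) blast
  let ?P = "matching_prog q :: 'd prog"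
  let ?R = "\<lambda>n m. n * (n * (CARD('d) * (m * m)))"
  have "poly_bounded (\<lambda>n m. poly (time_bound ?P) (store_bound q CARD('d) n (?R n m)))"
    by (intro poly_bounded_poly poly_bounded_store_bound poly_bounded_mult poly_bounded_const
        poly_bounded_fst poly_bounded_snd)
  then obtain p :: "nat poly poly" where
    p: "\<And>n m. poly (time_bound ?P) (store_bound q CARD('d) n (?R n m)) \<le> poly (poly p [:n:]) m"
    unfolding poly_bounded_def by blast
  show ?thesis
  proof (intro exI[of _ ?P] exI[of _ p] allI impI)
    fix n :: nat and w :: "'d \<Rightarrow> nat \<times> nat \<Rightarrow> int" and f :: "real ^ 'd \<Rightarrow> real"
    assume n: "1 \<le> n" and f: "convex_on UNIV f"
    interpret matching_instance n "\<lambda>k i j. w k (nat i, nat j)" q f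
      by standard (rule n)
    have input: "inputs (input_store n w)"
      by (auto simp: inputs_def input_store_def)
    have "bounded_store V (input_store n w)"
      unfolding bounded_store_def
    proof (intro allI)
      fix x i j
      have "\<bar>w k (nat i, nat j)\<bar> \<le> int V" if "i \<in> N" "j \<in> N" for k
        using wt_le_radius[OF that, of k] V_ge(3) by simp
      then show "\<bar>input_store n w x i j\<bar> \<le> int V"
        using V_ge(2) by (cases x) (simp_all add: input_store_def)
    qed
    from runs_matching_prog[OF this input] have
      "runs' ?P (input_store n w) (\<lambda>s'. \<exists>\<sigma>\<in>perms n. output_matching n s' = matching_of n \<sigma> \<and>
        (\<forall>c. (\<forall>k. \<bar>c k\<bar> \<le> int C) \<longrightarrow> handled c \<sigma>))"
      by (simp add: input_store_def)
    then obtain t k s \<sigma> where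
      run: "exec (comparison_oracle f) ?P (input_store n w) t k s"
      and time: "t + k \<le> poly (time_bound ?P) V"
      and \<sigma>: "\<sigma> \<in> perms n" and out: "output_matching n s = matching_of n \<sigma>"
      and handled: "\<forall>c. (\<forall>k. \<bar>c k\<bar> \<le> int C) \<longrightarrow> handled c \<sigma>"
      unfolding runs_def by (elim exE conjE bexE)
    have objective: "f (weight_vector w (matching_of n \<tau>)) = objective \<tau>" for \<tau>
      by (simp add: weight_vector_def sum_matching_of objective_def val_def)
    have "optimal_matching n w f (output_matching n s)"
      unfolding optimal_matching_def out
    proof (intro conjI allI impI)
      show "perfect_matching n (matching_of n \<sigma>)" using \<sigma> by (rule perfect_matching_of)
      fix M assume "perfect_matching n M"
      then obtain \<tau> where \<tau>: "\<tau> \<in> perms n" and M: "M = matching_of n \<tau>" by (rule perfect_matchingE)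
      have "objective \<tau> \<le> objective \<sigma>"
        by (rule handled_all_optimal[OF q f handled[rule_format] \<tau>]) blast+
      then show "f (weight_vector w M) \<le> f (weight_vector w (matching_of n \<sigma>))"
        by (simp only: M objective)
    qed
    moreover have "t + k \<le> poly (poly p [:n:]) (max_abs_weight n w)"
    proof -
      have "poly (time_bound ?P) V \<le> poly (time_bound ?P) (store_bound q CARD('d) n (?R n (max_abs_weight n w)))"
        by (intro poly_mono_nat store_bound_mono radius_le)
      with time p[of n "max_abs_weight n w"] show ?thesis by linarith
    qed
    ultimately show "\<exists>t q s. exec (comparison_oracle f) ?P (input_store n w) t q s \<and>
        optimal_matching n w f (output_matching n s) \<and>
        t + q \<le> poly (poly p [:n:]) (max_abs_weight n w)"
      using run by blast
  qed
qed

end
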